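(* Let $n_1\ge n_2\ge n_3$ and let $\mathcal{F}\in\mathbb{C}^{n_1\times n_2\times n_3}$ be a tensor of rank $r$ with $n_2<r\le n_1$, with reduced tensor slices $T_1,\dots,T_{n_3}\in\mathbb{C}^{r\times n_2}$. Let $x^*\in\mathbb{C}^d$ be a global optimizer of the second-stage problem $$\min_{x\in\mathbb{C}^d}\ \tfrac12\|g(x)\|_2^2$$ such that $g(x^* )=0$, and let $P_k:=P_k(x^* )\in\mathbb{C}^{r\times(r-n_2)}$ for $2\le k\le n_3$. If the $r\times r$ matrices $\begin{pmatrix}T_k&P_k\end{pmatrix}$ are all diagonalizable such that $$S_k\begin{pmatrix}T_k&P_k\end{pmatrix}=D_kS_k\qquad\text{for }2\le k\le n_3,$$ where $S_k\in\mathbb{C}^{r\times r}$ and $D_k\in\mathbb{C}^{r\times r}$ is a diagonal matrix, then, in the generic case, $S_2=\dots=S_{n_3}$ is nonsingular and, writing $S:=S_2=\dots=S_{n_3}$, $\mathcal{F}$ has the tensor decomposition $$\mathcal{F}=U^{(1)}\circ U^{(2)}\circ U^{(3)},$$ where $U^{(2)}=(S_{:,1:n_2})^\top$, $U^{(3)}\in\mathbb{C}^{n_3\times r}$ has entries $U^{(3)}_{1,i}=1$ and $U^{(3)}_{k,i}=(D_k)_{i,i}$ for $2\le k\le n_3$, $1\le i\le r$, and $U^{(1)}\in\mathbb{C}^{n_1\times r}$ is such that $X=(U^{(1)})^\top$ is a solution of the linear least squares system $(U^{(2)}\odot U^{(3)})X=\mathrm{Flatten}(\mathcal{F},1)^\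top$.
   Context: Notation. For matrices $U^{(j)}$ with $r$ columns, $U^{(1)}\circ U^{(2)}\circ U^{(3)}:=\sum_{s=1}^r U^{(1)}_{:,s}\otimes U^{(2)}_{:,s}\otimes U^{(3)}_{:,s}$, where $(u\otimes v\otimes w)_{i_1,i_2,i_3}=u_{i_1}v_{i_2}w_{i_3}$. The rank of a tensor is the smallest number of rank-1 tensors $u\otimes v\otimes w$ summing to it. $M_{:,a:b}$ denotes columns $a,\dots,b$ of $M$; $\mathrm{vec}$ stacks columns. For $A=(a_1,\dots,a_r)$, $B=(b_1,\dots,b_r)$, $A\odot B:=(b_1\boxtimes a_1,\dots,b_r\boxtimes a_r)$, with $\boxtimes$ the Kronecker product. $\mathrm{Flatten}(\mathcal{F},1)\in\mathbb{C}^{n_1\times n_2n_3}$ has entries $\mathrm{Flatten}(\mathcal{F},1)_{i_1,\,1+(i_2-1)+(i_3-1)n_2}=\mathcal{F}_{i_1,i_2,i_3}$. Reduced tensor. In the generic case $\mathcal{F}_{1:r,:,1}\in\mathbb{C}^{r\times n_2}$ has full column rank. Choose $C\in\mathbb{C}^{r\times(r-n_2)}$ such that $\hat F=(\mathcal{F}_{1:r,:,1}\ \ C)$ is nonsingular, and put $P=\hat F^{-1}$. The reduced tensor has slices $T_k=P\,\mathcal{F}_{1:r,:,k}$, $1\le k\le n_3$; in particular $T_1=(I_r)_{:,1:n_2}$, with $I_r$ the identity matrix. Second-stage problem. Let $s^1,\dots,s^p\in\mathbb{C}^r$ ($p<r$) be the linearly independent generalized left common eigenvectors of $T_2,\dots,T_{n_3}$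 already found by the first stage: $(s^i)^\top T_k=\lambda_{i,k}(s^i_{1:n_2})^\top$ with $s^i_{1:n_2}\neq0$, for $1\le i\le p$, $2\le k\le n_3$. Put $S^p=(s^1,\dots,s^p)^\top$ and $\Lambda_k=\mathrm{diag}(\lambda_{1,k},\dots,\lambda_{p,k})$. Consider the following linear system in unknown matrices $P_2,\dots,P_{n_3}\in\mathbb{C}^{r\times(r-n_2)}$: $$\begin{pmatrix}T_i&P_i\end{pmatrix}T_j-\begin{pmatrix}T_j&P_j\end{pmatrix}T_i=0\quad(2\le i<j\le n_3),\qquad S^pP_k=\Lambda_k(S^p)_{:,n_2+1:r}\quad(2\le k\le n_3).$$ Let $(P_2^0,\dots,P_{n_3}^0)$ be a particular solution of this system, and let $N$ be a matrix whose $d$ columns form a basis of the solution space of the corresponding homogeneous system in the stacked vector $(\mathrm{vec}(P_2)^\top,\dots,\mathrm{vec}(P_{n_3})^\top)^\top$. With $N_k$ the block of rows of $N$ corresponding to $\mathrm{vec}(P_k)$, the solutions are parametrized by $x\in\mathbb{C}^d$ via $\mathrm{vec}(P_k(x))=\mathrm{vec}(P_k^0)+N_kx$. Finally, $g(x)$ is the vector obtained by concatenating, over $2\le i<j\le n_3$, the vectors $$\mathrm{vec}\Big(\begin{pmatrix}T_i&P_i(x)\end{pmatrix}P_j(x)-\begin{pmatrix}T_j&P_j(x)\end{pmatrix}P_i(x)\Big).$$ "In the generic case" is the source's wording, which it does not define further; it is to be read in the usual sense, that is, for tensors $\mathcal{F}=W^{(1)}\circ W^{(2)}\circ W^{(3)}$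 of rank $r$ whose decomposition matrices $(W^{(1)},W^{(2)},W^{(3)})$ avoid a proper Zariski closed subset of $\mathbb{C}^{n_1\times r}\times\mathbb{C}^{n_2\times r}\times\mathbb{C}^{n_3\times r}$.
   Formalization: S_2=…=S_{n3} fails for arbitrary S_k, since rows can be rescaled; it is read as: if each (T_k P_k) is diagonalizable by some nonsingular S_k, a common nonsingular S diagonalizing all of them exists, and every such S with its D_k gives the stated decomposition. *)

theory Defs
  imports "HOL-Analysis.L2_Norm" "Jordan_Normal_Form.DL_Rank"
begin

text \<open>All indices are 0-based, so the index range \<open>2 \<le> k \<le> n\<^sub>3\<close> of the source is \<open>1 \<le> k < n3\<close>
  here, and slice number 0 is the first slice.\<close>

section \<open>Matrices and vectors\<close>

definition hcat :: "complex mat \<Rightarrow> complex mat \<Rightarrow> complex mat" where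
  "hcat A B = four_block_mat A B (0\<^sub>m 0 (dim_col A)) (0\<^sub>m 0 (dim_col B))"

text \<open>Columns (rows) \<open>a, \<dots>, b - 1\<close>.\<close>

definition col_range :: "complex mat \<Rightarrow> nat \<Rightarrow> nat \<Rightarrow> complex mat" where
  "col_range M a b = mat (dim_row M) (b - a) (\<lambda>(i, j). M $$ (i, a + j))"

definition row_range :: "complex mat \<Rightarrow> nat \<Rightarrow> nat \<Rightarrow> complex mat" where
  "row_range M a b = mat (b - a) (dim_col M) (\<lambda>(i, j). M $$ (a + i, j))"

text \<open>Column stacking \<open>vec(M)\<close> and its inverse.\<close>

definition vec_of_mat :: "complex mat \<Rightarrow> complex vec" where
  "vec_of_mat M = vec (dim_row M * dim_col M) (\<lambda>l. M $$ (l mod dim_row M, l div dim_row M))"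

definition mat_of_vec :: "nat \<Rightarrow> nat \<Rightarrow> complex vec \<Rightarrow> complex mat" where
  "mat_of_vec nr nc v = mat nr nc (\<lambda>(i, j). v $ (i + j * nr))"

definition concat_vecs :: "complex vec list \<Rightarrow> complex vec" where
  "concat_vecs vs = vec_of_list (concat (map list_of_vec vs))"

definition norm2 :: "complex vec \<Rightarrow> real" where
  "norm2 v = L2_set (\<lambda>i. cmod (v $ i)) {..<dim_vec v}"

definition kron_vec :: "complex vec \<Rightarrow> complex vec \<Rightarrow> complex vec" where
  "kron_vec u v = vec (dim_vec u * dim_vec v) (\<lambda>l. u $ (l div dim_vec v) * v $ (l mod dim_vec v))"

text \<open>The product \<open>A \<odot> B\<close>, whose columns are \<open>b\<^sub>s \<boxtimes> a\<^sub>s\<close>: the factor from \<open>B\<close> comes first.\<close>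

definition khatri_rao :: "complex mat \<Rightarrow> complex mat \<Rightarrow> complex mat" where
  "khatri_rao A B = mat_of_cols (dim_row B * dim_row A)
     (map (\<lambda>s. kron_vec (col B s) (col A s)) [0..<dim_col A])"

text \<open>\<open>X\<close> minimizes the Frobenius norm of \<open>A X - B\<close>.\<close>

definition least_squares_solution :: "complex mat \<Rightarrow> complex mat \<Rightarrow> complex mat \<Rightarrow> bool" where
  "least_squares_solution A B X \<longleftrightarrow>
     X \<in> carrier_mat (dim_col A) (dim_col B) \<and>
     (\<forall>Y \<in> carrier_mat (dim_col A) (dim_col B).
        norm2 (vec_of_mat (A * X - B)) \<le> norm2 (vec_of_mat (A * Y - B)))"

definition lin_independent :: "nat \<Rightarrow> complex vec list \<Rightarrow> bool" where
  "lin_independent n vs \<longleftrightarrow> set vs \<subseteq> carrier_vec n \<and> distinct vs \<and>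
     LinearCombinations.module.lin_indpt class_ring (module_vec TYPE(complex) n) (set vs)"

definition is_basis_of :: "nat \<Rightarrow> complex vec list \<Rightarrow> complex vec set \<Rightarrow> bool" where
  "is_basis_of n vs V \<longleftrightarrow> lin_independent n vs \<and>
     LinearCombinations.module.span class_ring (module_vec TYPE(complex) n) (set vs) = V"

text \<open>\<open>S\<close> is determined by \<open>M\<close> at best up to permuting and rescaling its rows (left eigenvectors of \<open>M\<close>).
  Equality of the diagonalizing matrices of several \<open>M\<^sub>k\<close> therefore means that a common choice of
  \<open>S\<close> exists; the diagonal matrices follow that choice.\<close>

definition diagonalizes :: "nat \<Rightarrow> complex mat \<Rightarrow> complex mat \<Rightarrow> complex mat \<Rightarrow> bool" where
  "diagonalizes r S D M \<longleftrightarrow> S \<in> carrier_mat r r \<and> invertible_mat S \<and>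
     D \<in> carrier_mat r r \<and> diagonal_mat D \<and> S * M = D * S"


section \<open>Third-order tensors\<close>

text \<open>A tensor of format \<open>n1 \<times> n2 \<times> n3\<close> is a function of three indices that is \<open>0\<close> outside the
  index range, so that equality of tensors is equality of functions.\<close>

type_synonym tensor = "nat \<Rightarrow> nat \<Rightarrow> nat \<Rightarrow> complex"

definition outer :: "complex vec \<Rightarrow> complex vec \<Rightarrow> complex vec \<Rightarrow> tensor" where
  "outer u v w = (\<lambda>i j k. if i < dim_vec u \<and> j < dim_vec v \<and> k < dim_vec w
     then u $ i * v $ j * w $ k else 0)"

definition cp_tensor :: "complex mat \<Rightarrow> complex mat \<Rightarrow> complex mat \<Rightarrow> tensor" where
  "cp_tensor U V W = (\<lambda>i j k. \<Sum>s<dim_col U. outer (col U s) (col V s) (col W s) i j k)"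

definition tensor_rank :: "nat \<Rightarrow> nat \<Rightarrow> nat \<Rightarrow> tensor \<Rightarrow> nat" where
  "tensor_rank n1 n2 n3 F = (LEAST m. \<exists>u v w.
     (\<forall>s<m. u s \<in> carrier_vec n1 \<and> v s \<in> carrier_vec n2 \<and> w s \<in> carrier_vec n3) \<and>
     F = (\<lambda>i j k. \<Sum>s<m. outer (u s) (v s) (w s) i j k))"

text \<open>\<open>\<F>\<^bsub>1:r,:,k\<^esub>\<close>\<close>

definition slice :: "nat \<Rightarrow> nat \<Rightarrow> tensor \<Rightarrow> nat \<Rightarrow> complex mat" where
  "slice r n2 F k = mat r n2 (\<lambda>(i, j). F i j k)"

definition flatten1 :: "nat \<Rightarrow> nat \<Rightarrow> nat \<Rightarrow> tensor \<Rightarrow> complex mat" where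
  "flatten1 n1 n2 n3 F = mat n1 (n2 * n3) (\<lambda>(i, l). F i (l mod n2) (l div n2))"


section \<open>Genericity\<close>

text \<open>Polynomial functions in the coordinate functions \<open>X\<close>.\<close>

inductive polynomial_fun :: "('a \<Rightarrow> complex) set \<Rightarrow> ('a \<Rightarrow> complex) \<Rightarrow> bool"
  for X where
  const: "polynomial_fun X (\<lambda>_. c)"
| coord: "f \<in> X \<Longrightarrow> polynomial_fun X f"
| add: "polynomial_fun X f \<Longrightarrow> polynomial_fun X g \<Longrightarrow> polynomial_fun X (\<lambda>a. f a + g a)"
| mult: "polynomial_fun X f \<Longrightarrow> polynomial_fun X g \<Longrightarrow> polynomial_fun X (\<lambda>a. f a * g a)"

type_synonym mat_triple = "complex mat \<times> complex mat \<times> complex mat"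

definition mat_triples :: "nat \<Rightarrow> nat \<Rightarrow> nat \<Rightarrow> nat \<Rightarrow> mat_triple set" where
  "mat_triples n1 n2 n3 r = carrier_mat n1 r \<times> carrier_mat n2 r \<times> carrier_mat n3 r"

definition entry_functions :: "nat \<Rightarrow> nat \<Rightarrow> nat \<Rightarrow> nat \<Rightarrow> (mat_triple \<Rightarrow> complex) set" where
  "entry_functions n1 n2 n3 r =
     {(\<lambda>(W1, W2, W3). W1 $$ (i, s)) | i s. i < n1 \<and> s < r} \<union>
     {(\<lambda>(W1, W2, W3). W2 $$ (i, s)) | i s. i < n2 \<and> s < r} \<union>
     {(\<lambda>(W1, W2, W3). W3 $$ (i, s)) | i s. i < n3 \<and> s < r}"

definition zariski_closed :: "nat \<Rightarrow> nat \<Rightarrow> nat \<Rightarrow> nat \<Rightarrow> mat_triple set \<Rightarrow> bool" where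
  "zariski_closed n1 n2 n3 r Z \<longleftrightarrow>
     (\<exists>Q. (\<forall>q \<in> Q. polynomial_fun (entry_functions n1 n2 n3 r) q) \<and>
          Z = {W \<in> mat_triples n1 n2 n3 r. \<forall>q \<in> Q. q W = 0})"

definition generically :: "nat \<Rightarrow> nat \<Rightarrow> nat \<Rightarrow> nat \<Rightarrow> (tensor \<Rightarrow> bool) \<Rightarrow> bool" where
  "generically n1 n2 n3 r \<Phi> \<longleftrightarrow>
     (\<exists>Z. zariski_closed n1 n2 n3 r Z \<and> Z \<noteq> mat_triples n1 n2 n3 r \<and>
       (\<forall>(W1, W2, W3) \<in> mat_triples n1 n2 n3 r - Z.
          tensor_rank n1 n2 n3 (cp_tensor W1 W2 W3) = r \<longrightarrow> \<Phi> (cp_tensor W1 W2 W3)))"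


section \<open>The reduced tensor and the second-stage problem\<close>

definition reduction :: "nat \<Rightarrow> nat \<Rightarrow> tensor \<Rightarrow> complex mat \<Rightarrow> complex mat \<Rightarrow> bool" where
  "reduction r n2 F C P \<longleftrightarrow>
     C \<in> carrier_mat r (r - n2) \<and> P \<in> carrier_mat r r \<and>
     inverts_mat P (hcat (slice r n2 F 0) C) \<and> inverts_mat (hcat (slice r n2 F 0) C) P"

definition reduced_slice :: "nat \<Rightarrow> nat \<Rightarrow> tensor \<Rightarrow> complex mat \<Rightarrow> nat \<Rightarrow> complex mat" where
  "reduced_slice r n2 F P k = P * slice r n2 F k"

text \<open>The vectors \<open>s\<^sup>1, \<dots>, s\<^sup>p\<close> are the entries of the list \<open>ss\<close>; the row vector equation
  \<open>s\<^sup>T T\<^sub>k = \<lambda> s\<^sub>1\<^sub>:\<^sub>n\<^sub>2\<^sup>T\<close> is stated in transposed form.\<close>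

definition first_stage_vectors ::
  "nat \<Rightarrow> nat \<Rightarrow> nat \<Rightarrow> (nat \<Rightarrow> complex mat) \<Rightarrow> complex vec list \<Rightarrow> (nat \<Rightarrow> nat \<Rightarrow> complex) \<Rightarrow> bool"
where
  "first_stage_vectors r n2 n3 T ss lam \<longleftrightarrow>
     length ss < r \<and> lin_independent r ss \<and>
     (\<forall>i < length ss. vec_first (ss ! i) n2 \<noteq> 0\<^sub>v n2 \<and>
        (\<forall>k \<in> {1..<n3}. (T k)\<^sup>T *\<^sub>v (ss ! i) = lam i k \<cdot>\<^sub>v vec_first (ss ! i) n2))"

definition second_stage_system ::
  "nat \<Rightarrow> nat \<Rightarrow> nat \<Rightarrow> (nat \<Rightarrow> complex mat) \<Rightarrow> complex vec list \<Rightarrow> (nat \<Rightarrow> nat \<Rightarrow> complex)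
     \<Rightarrow> (nat \<Rightarrow> complex mat) \<Rightarrow> bool"
where
  "second_stage_system r n2 n3 T ss lam P \<longleftrightarrow>
     (\<forall>k \<in> {1..<n3}. P k \<in> carrier_mat r (r - n2)) \<and>
     (\<forall>i j. 1 \<le> i \<and> i < j \<and> j < n3 \<longrightarrow>
        hcat (T i) (P i) * T j - hcat (T j) (P j) * T i = 0\<^sub>m r n2) \<and>
     (\<forall>k \<in> {1..<n3}. mat_of_rows r ss * P k =
        mat_diag (length ss) (\<lambda>i. lam i k) * col_range (mat_of_rows r ss) n2 r)"

text \<open>The terms \<open>T\<^sub>i\<close> inside the block matrices only contribute the constants
  \<open>T\<^sub>i (T\<^sub>j)\<^bsub>1:n\<^sub>2,:\<^esub>\<close> to the system above, so the corresponding homogeneous system is obtained by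
  replacing these blocks, and the right-hand side of the last equation, by 0.\<close>

definition homogeneous_system ::
  "nat \<Rightarrow> nat \<Rightarrow> nat \<Rightarrow> (nat \<Rightarrow> complex mat) \<Rightarrow> complex vec list \<Rightarrow> (nat \<Rightarrow> complex mat) \<Rightarrow> bool"
where
  "homogeneous_system r n2 n3 T ss P \<longleftrightarrow>
     (\<forall>k \<in> {1..<n3}. P k \<in> carrier_mat r (r - n2)) \<and>
     (\<forall>i j. 1 \<le> i \<and> i < j \<and> j < n3 \<longrightarrow>
        hcat (0\<^sub>m r n2) (P i) * T j - hcat (0\<^sub>m r n2) (P j) * T i = 0\<^sub>m r n2) \<and>
     (\<forall>k \<in> {1..<n3}. mat_of_rows r ss * P k = 0\<^sub>m (length ss) (r - n2))"

definition stacked :: "nat \<Rightarrow> (nat \<Rightarrow> complex mat) \<Rightarrow> complex vec" where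
  "stacked n3 P = concat_vecs (map (\<lambda>k. vec_of_mat (P k)) [1..<n3])"

definition nullspace_basis ::
  "nat \<Rightarrow> nat \<Rightarrow> nat \<Rightarrow> (nat \<Rightarrow> complex mat) \<Rightarrow> complex vec list \<Rightarrow> nat \<Rightarrow> complex mat \<Rightarrow> bool"
where
  "nullspace_basis r n2 n3 T ss d N \<longleftrightarrow>
     N \<in> carrier_mat ((n3 - 1) * (r * (r - n2))) d \<and>
     is_basis_of ((n3 - 1) * (r * (r - n2))) (cols N)
       {stacked n3 P | P. homogeneous_system r n2 n3 T ss P}"

text \<open>\<open>P\<^sub>k(x)\<close>, given by \<open>vec(P\<^sub>k(x)) = vec(P\<^sub>k\<^sup>0) + N\<^sub>k x\<close>.\<close>

definition param_sol ::
  "nat \<Rightarrow> nat \<Rightarrow> (nat \<Rightarrow> complex mat) \<Rightarrow> complex mat \<Rightarrow> complex vec \<Rightarrow> nat \<Rightarrow> complex mat"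
where
  "param_sol r n2 P0 N x k = mat_of_vec r (r - n2)
     (vec_of_mat (P0 k) +
      row_range N ((k - 1) * (r * (r - n2))) (k * (r * (r - n2))) *\<^sub>v x)"

text \<open>\<open>g(x)\<close>\<close>

definition residual ::
  "nat \<Rightarrow> nat \<Rightarrow> nat \<Rightarrow> (nat \<Rightarrow> complex mat) \<Rightarrow> (nat \<Rightarrow> complex mat) \<Rightarrow> complex mat
     \<Rightarrow> complex vec \<Rightarrow> complex vec"
where
  "residual r n2 n3 T P0 N x = (let P = param_sol r n2 P0 N x in
     concat_vecs [vec_of_mat (hcat (T i) (P i) * P j - hcat (T j) (P j) * P i).
       i \<leftarrow> [1..<n3], j \<leftarrow> [Suc i..<n3]])"

definition global_minimizer :: "nat \<Rightarrow> (complex vec \<Rightarrow> complex vec) \<Rightarrow> complex vec \<Rightarrow> bool" where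
  "global_minimizer d g x \<longleftrightarrow> x \<in> carrier_vec d \<and>
     (\<forall>y \<in> carrier_vec d. 1 / 2 * (norm2 (g x))\<^sup>2 \<le> 1 / 2 * (norm2 (g y))\<^sup>2)"


section \<open>The decomposition matrices\<close>

definition U2 :: "nat \<Rightarrow> complex mat \<Rightarrow> complex mat" where
  "U2 n2 S = (col_range S 0 n2)\<^sup>T"

definition U3 :: "nat \<Rightarrow> nat \<Rightarrow> (nat \<Rightarrow> complex mat) \<Rightarrow> complex mat" where
  "U3 n3 r D = mat n3 r (\<lambda>(k, i). if k = 0 then 1 else D k $$ (i, i))"

definition U1_candidate ::
  "nat \<Rightarrow> nat \<Rightarrow> nat \<Rightarrow> nat \<Rightarrow> tensor \<Rightarrow> complex mat \<Rightarrow> (nat \<Rightarrow> complex mat) \<Rightarrow> complex mat \<Rightarrow> bool"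
where
  "U1_candidate n1 n2 n3 r F S D U \<longleftrightarrow> U \<in> carrier_mat n1 r \<and>
     least_squares_solution (khatri_rao (U2 n2 S) (U3 n3 r D)) ((flatten1 n1 n2 n3 F)\<^sup>T) (U\<^sup>T)"

end

theory Submission
  imports Defs
begin

text \<open>Write \<open>M\<^sub>k = (T\<^sub>k P\<^sub>k)\<close>. The linear system and \<open>g(x) = 0\<close> together say that the \<open>M\<^sub>k\<close> commute
  pairwise, so being diagonalizable they are simultaneously diagonalizable. For a common \<open>S\<close> the first
  \<open>n\<^sub>2\<close> columns of \<open>S M\<^sub>k = D\<^sub>k S\<close> read \<open>T\<^sub>k = S\<^sup>-\<^sup>1 D\<^sub>k (U\<^sup>(\<^sup>2\<^sup>))\<^sup>T\<close>, which is a decomposition of the first \<open>r\<close>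
  horizontal slices of the tensor. When the first \<open>r\<close> rows of \<open>W\<^sup>(\<^sup>1\<^sup>)\<close> form a nonsingular matrix, the other
  horizontal slices are linear combinations of these, so the least squares system is consistent and
  all its solutions are exact. Besides this minor, genericity only enters through the rank of the
  first slice, which needs the leading \<open>n\<^sub>2\<close>-minor of \<open>W\<^sup>(\<^sup>2\<^sup>)\<close> and every entry of the first row
  of \<open>W\<^sup>(\<^sup>3\<^sup>)\<close> to be nonzero.\<close>

section \<open>Simultaneous diagonalization\<close>

lemma diagonal_mat_commute_index:
  fixes D B :: "'a :: field mat"
  assumes "D \<in> carrier_mat n n" "B \<in> carrier_mat n n" "diagonal_mat D" "i < n" "j < n"
  shows "(D * B) $$ (i, j) = D $$ (i, i) * B $$ (i, j)"
    and "(B * D) $$ (i, j) = B $$ (i, j) * D $$ (j, j)"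
proof -
  have "(D * B) $$ (i, j) = (\<Sum>l\<in>{0..<n}. D $$ (i, l) * B $$ (l, j))"
    using assms by (auto simp: scalar_prod_def)
  also have "\<dots> = (\<Sum>l\<in>{0..<n}. if l = i then D $$ (i, i) * B $$ (i, j) else 0)"
    using assms by (intro sum.cong) (auto simp: diagonal_mat_def)
  finally show "(D * B) $$ (i, j) = D $$ (i, i) * B $$ (i, j)"
    using assms by simp
  have "(B * D) $$ (i, j) = (\<Sum>l\<in>{0..<n}. B $$ (i, l) * D $$ (l, j))"
    using assms by (auto simp: scalar_prod_def)
  also have "\<dots> = (\<Sum>l\<in>{0..<n}. if l = j then B $$ (i, j) * D $$ (j, j) else 0)"
    using assms by (intro sum.cong) (auto simp: diagonal_mat_def)
  finally show "(B * D) $$ (i, j) = B $$ (i, j) * D $$ (j, j)"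
    using assms by simp
qed

lemma diagonal_mat_mat_diag: "diagonal_mat (mat_diag n f)"
  by (simp add: diagonal_mat_def mat_diag_def)

text \<open>\<open>E X\<close> is the projection onto the sum of the eigenspaces for the eigenvalues in \<open>X\<close>; it commutes
  with everything that commutes with \<open>A\<close>.\<close>

lemma spectral_projections:
  fixes A :: "'a :: field mat"
  assumes A: "A \<in> carrier_mat n n" and sim: "similar_mat_wit A D V W" and diag: "diagonal_mat D"
  obtains E \<Lambda> where "\<And>X. E X \<in> carrier_mat n n"
    and "\<And>B X. B \<in> carrier_mat n n \<Longrightarrow> A * B = B * A \<Longrightarrow> B * E X = E X * B"
    and "\<And>\<mu>. A * E {\<mu>} = \<mu> \<cdot>\<^sub>m E {\<mu>}"
    and "E {} = 0\<^sub>m n n"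
    and "\<And>\<mu> X. \<mu> \<notin> X \<Longrightarrow> E (insert \<mu> X) = E X + E {\<mu>}"
    and "finite \<Lambda>" and "E \<Lambda> = 1\<^sub>m n"
proof -
  note s = similar_mat_witD2[OF A sim]
  have V[simp]: "V \<in> carrier_mat n n" and W[simp]: "W \<in> carrier_mat n n" 
    and D[simp]: "D \<in> carrier_mat n n" and VW: "V * W = 1\<^sub>m n" and WV: "W * V = 1\<^sub>m n"
    and AE: "A = V * D * W" using s by auto
  note [simp] = A
  \<comment> \<open>\<open>G X\<close> marks the diagonal positions of \<open>D\<close> whose entry
    lies in \<open>X\<close>. Conjugation with \<open>V\<close>, whose columns are eigenvectors of
    \<open>A\<close>, turns this coordinate projection into \<open>E X\<close>.\<close>
  define G where "G X = mat_diag n (\<lambda>j. if D $$ (j, j) \<in> X then 1 else (0::'a))" for X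
  define E where "E X = V * G X * W" for X
  define \<Lambda> where "\<Lambda> = (\<lambda>j. D $$ (j, j)) ` {..<n}"
  have G[simp]: "G X \<in> carrier_mat n n" for X by (simp add: G_def mat_diag_def)
  have Gd: "diagonal_mat (G X)" for X by (simp add: G_def diagonal_mat_mat_diag)
  \<comment> \<open>Cancellation inside right-nested products, the normal form produced by
    \<open>as\<close>.\<close>
  have WVx: "W * (V * Z) = Z" and VWx: "V * (W * Z) = Z" if "Z \<in> carrier_mat n n" for Z
  proof -
    have "W * (V * Z) = (W * V) * Z" using that by (subst assoc_mult_mat[of _ n n _ n _ n]) auto
    then show "W * (V * Z) = Z" using that by (simp add: WV)
    have "V * (W * Z) = (V * W) * Z" using that by (subst assoc_mult_mat[of _ n n _ n _ n]) auto
    then show "V * (W * Z) = Z" using that by (simp add: VW)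
  qed
  have mm[simp]: "X * Y \<in> carrier_mat n n"
    if "X \<in> carrier_mat n n" "Y \<in> carrier_mat n n" for X Y :: "'a mat"
    using that by (rule mult_carrier_mat)
  note as = assoc_mult_mat[of _ n n _ n _ n]
  show ?thesis
  proof
    show "E X \<in> carrier_mat n n" for X by (auto simp: E_def)
    show "B * E X = E X * B" if B[simp]: "B \<in> carrier_mat n n" and AB: "A * B = B * A" for B X
    proof -
      \<comment> \<open>\<open>H\<close> is \<open>B\<close> in the eigenbasis of \<open>A\<close>.
        Commuting with \<open>D\<close> forces \<open>H $$ (i, j) = 0\<close> unless the eigenvalues
        number \<open>i\<close> and \<open>j\<close> agree, and then \<open>G X\<close> has the same
        entry in both places, so \<open>H\<close> commutes with \<open>G X\<close>.\<close>
      define H where "H = W * B * V"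
      have H[simp]: "H \<in> carrier_mat n n" by (simp add: H_def)
      have "W * (A * B) * V = W * (B * A) * V" by (simp add: AB)
      then have DH: "D * H = H * D"
        by (simp add: AE H_def as WV WVx right_mult_one_mat[OF D])
      have "(D $$ (i, i) - D $$ (j, j)) * H $$ (i, j) = 0" if "i < n" "j < n" for i j
        using arg_cong[OF DH, of "\<lambda>M. M $$ (i, j)"] that
        by (simp add: diagonal_mat_commute_index[OF D H diag] algebra_simps del: index_mult_mat)
      then have eq: "H $$ (i, j) = 0 \<or> D $$ (i, i) = D $$ (j, j)" if "i < n" "j < n" for i j
        using that by fastforce
      have "G X * H = H * G X"
      proof (rule eq_matI)
        fix i j assume "i < dim_row (H * G X)" "j < dim_col (H * G X)"
        then have ij: "i < n" "j < n" using G[of X] H by auto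
        show "(G X * H) $$ (i, j) = (H * G X) $$ (i, j)"
          using eq[OF ij] ij unfolding diagonal_mat_commute_index[OF G H Gd ij]
          by (auto simp: G_def mat_diag_def)
      qed (use carrier_matD[OF G[of X]] carrier_matD[OF H] in auto)
      then have "V * (G X * H) * W = V * (H * G X) * W" by simp
      then show ?thesis by (simp add: E_def H_def as VW VWx right_mult_one_mat[OF B])
    qed
    show "A * E {\<mu>} = \<mu> \<cdot>\<^sub>m E {\<mu>}" for \<mu>
    proof -
      have "D * G {\<mu>} = \<mu> \<cdot>\<^sub>m G {\<mu>}"
      proof (rule eq_matI)
        fix i j assume "i < dim_row (\<mu> \<cdot>\<^sub>m G {\<mu>})" "j < dim_col (\<mu> \<cdot>\<^sub>m G {\<mu>})"
        then have ij: "i < n" "j < n" using G[of "{\<mu>}"] by auto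
        then show "(D * G {\<mu>}) $$ (i, j) = (\<mu> \<cdot>\<^sub>m G {\<mu>}) $$ (i, j)"
          using ij unfolding diagonal_mat_commute_index[OF D G diag ij]
          by (auto simp: G_def mat_diag_def)
      qed (use carrier_matD[OF G[of "{\<mu>}"]] carrier_matD[OF D] in auto)
      moreover have "A * E {\<mu>} = V * (D * G {\<mu>}) * W"
        by (simp add: AE E_def as WVx)
      ultimately show ?thesis
        by (simp add: E_def mult_smult_distrib[of V n n _ n] mult_smult_assoc_mat[of _ n n W n])
    qed
    have "G {} = 0\<^sub>m n n" by (rule eq_matI) (auto simp: G_def mat_diag_def)
    then show "E {} = 0\<^sub>m n n" by (simp add: E_def right_mult_zero_mat[of V n n n] left_mult_zero_mat[of W n n n])
    show "E (insert \<mu> X) = E X + E {\<mu>}" if "\<mu> \<notin> X" for \<mu> X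
    proof -
      have "G (insert \<mu> X) = G X + G {\<mu>}" using that
        by (intro eq_matI) (auto simp: G_def mat_diag_def)
      then show ?thesis
        by (simp add: E_def mult_add_distrib_mat[of V n n _ n] add_mult_distrib_mat[of _ n n _ W n])
    qed
    show "finite \<Lambda>" by (simp add: \<Lambda>_def)
    have "G \<Lambda> = 1\<^sub>m n" by (intro eq_matI) (auto simp: G_def mat_diag_def \<Lambda>_def)
    then show "E \<Lambda> = 1\<^sub>m n" by (simp add: E_def VW right_mult_one_mat[of V n n])
  qed
qed

text \<open>The zero vector is included. This does no harm: only the span matters, and the vectors
  finally selected are columns of an invertible matrix.\<close>

definition joint_eigenvectors :: "nat \<Rightarrow> ('k \<Rightarrow> 'a :: field mat) \<Rightarrow> 'k set \<Rightarrow> 'a vec set" where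
  "joint_eigenvectors n A K = {v \<in> carrier_vec n. \<forall>k\<in>K. \<exists>c. A k *\<^sub>v v = c \<cdot>\<^sub>v v}"

text \<open>Induction on \<open>K\<close>. For no matrices every vector qualifies; each further
  matrix splits the joint eigenvectors found so far by its spectral projections. Speaking of spans
  instead of bases avoids counting the dimensions of the pieces.\<close>

lemma (in vec_space) span_joint_eigenvectors:
  assumes "finite K"
    and "\<And>k. k \<in> K \<Longrightarrow> A k \<in> carrier_mat n n"
    and "\<And>k. k \<in> K \<Longrightarrow> \<exists>D V W. similar_mat_wit (A k) D V W \<and> diagonal_mat D"
    and "\<And>i j. i \<in> K \<Longrightarrow> j \<in> K \<Longrightarrow> A i * A j = A j * A i"
  shows "span (joint_eigenvectors n A K) = carrier_vec n"
  using assms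
proof (induction K rule: finite_induct)
  case empty
  have "joint_eigenvectors n A {} = carrier_vec n" by (auto simp: joint_eigenvectors_def)
  then show ?case using in_own_span[of "carrier_vec n"] span_closed[of "carrier_vec n"] by auto
next
  case (insert m K)
  let ?J = "joint_eigenvectors n A K" and ?J' = "joint_eigenvectors n A (insert m K)"
  have IH: "span ?J = carrier_vec n" using insert by simp
  have J': "?J' \<subseteq> carrier_vec n" by (auto simp: joint_eigenvectors_def)
  have Am: "A m \<in> carrier_mat n n" using insert by simp
  obtain D V W where sim: "similar_mat_wit (A m) D V W" and diag: "diagonal_mat D"
    using insert.prems(2) by blast
  obtain E \<Lambda> where E: "\<And>X. E X \<in> carrier_mat n n"
    and com: "\<And>B X. B \<in> carrier_mat n n \<Longrightarrow> A m * B = B * A m \<Longrightarrow> B * E X = E X * B"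
    and eig: "\<And>\<mu>. A m * E {\<mu>} = \<mu> \<cdot>\<^sub>m E {\<mu>}"
    and E0: "E {} = 0\<^sub>m n n"
    and Ei: "\<And>\<mu> X. \<mu> \<notin> X \<Longrightarrow> E (insert \<mu> X) = E X + E {\<mu>}"
    and fin: "finite \<Lambda>" and E1: "E \<Lambda> = 1\<^sub>m n"
    using spectral_projections[OF Am sim diag] by metis
  \<comment> \<open>\<open>v\<close> is the sum of its projections to the eigenspaces of \<open>A m\<close>, which are still eigenvectors of the
    other matrices.\<close>
  have "v \<in> span ?J'" if v: "v \<in> ?J" for v
  proof -
    have vc: "v \<in> carrier_vec n" using v by (auto simp: joint_eigenvectors_def)
    have Ev: "E {\<mu>} *\<^sub>v v \<in> ?J'" for \<mu>
    proof -
      have "\<exists>c. A k *\<^sub>v (E {\<mu>} *\<^sub>v v) = c \<cdot>\<^sub>v (E {\<mu>} *\<^sub>v v)" if k: "k \<in> insert m K" for k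
      proof (cases "k = m")
        case True
        have "A m *\<^sub>v (E {\<mu>} *\<^sub>v v) = (A m * E {\<mu>}) *\<^sub>v v"
          using Am E vc by (simp add: assoc_mult_mat_vec[of _ n n _ n])
        moreover have "(\<mu> \<cdot>\<^sub>m E {\<mu>}) *\<^sub>v v = \<mu> \<cdot>\<^sub>v (E {\<mu>} *\<^sub>v v)"
          using E[of "{\<mu>}"] vc by (intro eq_vecI) (auto simp: row_smult[of _ "E {\<mu>}"])
        ultimately show ?thesis using True eig by auto
      next
        case False
        then have k: "k \<in> K" using k by simp
        then obtain c where c: "A k *\<^sub>v v = c \<cdot>\<^sub>v v" using v by (auto simp: joint_eigenvectors_def)
        have Ak: "A k \<in> carrier_mat n n" using insert.prems k by simp
        have "A k * E {\<mu>} = E {\<mu>} * A k"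
          using insert.prems k by (intro com[OF Ak]) auto
        then have "A k *\<^sub>v (E {\<mu>} *\<^sub>v v) = E {\<mu>} *\<^sub>v (A k *\<^sub>v v)"
          using Ak E vc by (metis assoc_mult_mat_vec)
        then show ?thesis using c mult_mat_vec[OF E[of "{\<mu>}"] vc, of c] by auto
      qed
      then show ?thesis
        using mult_mat_vec_carrier[OF E[of "{\<mu>}"] vc] by (auto simp: joint_eigenvectors_def)
    qed
    have "finite X \<Longrightarrow> E X *\<^sub>v v \<in> span ?J'" for X
    proof (induction X rule: finite_induct)
      case empty
      have "0\<^sub>v n \<in> span ?J'"
        using in_spanI[of "0\<^sub>v n" undefined "{}"] by (simp add: lincomb_def)
      moreover have "0\<^sub>m n n *\<^sub>v v = 0\<^sub>v n" using vc by (intro eq_vecI) auto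
      ultimately show ?case using E0 by simp
    next
      case (insert \<mu> X)
      have "E (insert \<mu> X) *\<^sub>v v = E X *\<^sub>v v + E {\<mu>} *\<^sub>v v"
        unfolding Ei[OF insert(2)] using E vc by (intro add_mult_distrib_mat_vec)
      moreover have "E {\<mu>} *\<^sub>v v \<in> span ?J'" using in_own_span[of ?J'] J' Ev by auto
      ultimately show ?case using insert span_add1[of ?J'] J' by simp
    qed
    from this[OF fin] show ?thesis using E1 vc by simp
  qed
  then have "span ?J \<subseteq> span ?J'" using span_subsetI[OF J'] by blast
  then show ?case using IH span_closed[of ?J'] J' by auto
qed

text \<open>A maximal independent subset of \<open>J\<close> exists because independent sets have at
  most \<open>n\<close> elements. By maximality it spans \<open>J\<close>, so it is a basis, and its
  elements are the columns of a matrix of full rank.\<close>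

lemma (in vec_space) span_contains_invertible:
  assumes J: "J \<subseteq> carrier_vec n" and span: "span J = carrier_vec n"
  obtains V where "V \<in> carrier_mat n n" "det V \<noteq> 0" "set (cols V) \<subseteq> J"
proof -
  have "\<exists>B. finite B \<and> maximal B (\<lambda>B. B \<subseteq> J \<and> lin_indpt B)"
  proof (rule maximal_exists[where B = "{}" and N = n])
    show "finite B \<and> card B \<le> n" if "B \<subseteq> J \<and> lin_indpt B" for B
      using li_le_dim[of B] fin_dim dim_is_n that J by auto
    show "{} \<subseteq> J \<and> lin_indpt {}" by (auto simp: lin_dep_def)
  qed
  then obtain B where finB: "finite B" and BJ: "B \<subseteq> J" and ind: "lin_indpt B"
    and max: "\<And>C. B \<subseteq> C \<Longrightarrow> C \<subseteq> J \<Longrightarrow> lin_indpt C \<Longrightarrow> C = B"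
    unfolding maximal_def by auto
  have Bc: "B \<subseteq> carrier_vec n" using BJ J by auto
  have "v \<in> span B" if v: "v \<in> J" for v
  proof (cases "v \<in> B")
    case True
    then show ?thesis using in_own_span[of B] Bc by auto
  next
    case False
    have "lin_dep (B \<union> {v})" using max[of "B \<union> {v}"] BJ v False by auto
    then show ?thesis using lin_dep_iff_in_span[of B v] Bc ind v J False by auto
  qed
  then have "span J \<subseteq> span B" using span_subsetI[OF Bc] by blast
  then have "span B = carrier_vec n" using span span_closed[of B] Bc by auto
  then have "basis B" unfolding basis_def using ind Bc by simp
  then have card: "card B = n" using dim_basis[OF finB] dim_is_n by simp
  obtain xs where xs: "set xs = B" "distinct xs" using finite_distinct_list[OF finB] by blast
  let ?V = "mat_of_cols n xs"
  have len: "length xs = n" using xs card distinct_card by fastforce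
  have V: "?V \<in> carrier_mat n n" using len by auto
  have cols: "cols ?V = xs" using xs Bc by (intro cols_mat_of_cols) auto
  have "rank ?V = n" using lin_indpt_full_rank[OF V] cols xs ind by simp
  then have "det ?V \<noteq> 0" using det_rank_iff[OF V] by simp
  then show ?thesis using that[OF V] cols xs BJ by simp
qed

text \<open>The columns of \<open>V\<close> are joint eigenvectors; \<open>A k * V = V * D k\<close>
  collects their eigenvalue equations column by column.\<close>

lemma simultaneous_diagonalization:
  fixes A :: "'k \<Rightarrow> 'a :: field mat"
  assumes "finite K"
    and A: "\<And>k. k \<in> K \<Longrightarrow> A k \<in> carrier_mat n n"
    and "\<And>k. k \<in> K \<Longrightarrow> \<exists>D V W. similar_mat_wit (A k) D V W \<and> diagonal_mat D"
    and "\<And>i j. i \<in> K \<Longrightarrow> j \<in> K \<Longrightarrow> A i * A j = A j * A i"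
  obtains V D where "V \<in> carrier_mat n n" "det V \<noteq> 0"
    and "\<And>k. k \<in> K \<Longrightarrow> D k \<in> carrier_mat n n \<and> diagonal_mat (D k) \<and> A k * V = V * D k"
proof -
  interpret vec_space "TYPE('a)" n .
  have "joint_eigenvectors n A K \<subseteq> carrier_vec n" by (auto simp: joint_eigenvectors_def)
  from span_contains_invertible[OF this span_joint_eigenvectors[OF assms]]
  obtain V where V: "V \<in> carrier_mat n n" and det: "det V \<noteq> 0"
    and cols: "set (cols V) \<subseteq> joint_eigenvectors n A K" by blast
  have ex: "\<exists>c. A k *\<^sub>v col V j = c \<cdot>\<^sub>v col V j" if "k \<in> K" "j < n" for k j
  proof -
    have "col V j \<in> set (cols V)" using V that by (auto simp: cols_def)
    then show ?thesis using cols that by (auto simp: joint_eigenvectors_def)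
  qed
  define c where "c k j = (SOME c. A k *\<^sub>v col V j = c \<cdot>\<^sub>v col V j)" for k j
  have c: "A k *\<^sub>v col V j = c k j \<cdot>\<^sub>v col V j" if "k \<in> K" "j < n" for k j
    unfolding c_def using ex[OF that] by (rule someI_ex)
  have AV: "A k * V = V * mat_diag n (c k)" if k: "k \<in> K" for k
  proof (rule eq_matI)
    fix i j assume "i < dim_row (V * mat_diag n (c k))" "j < dim_col (V * mat_diag n (c k))"
    then have ij: "i < n" "j < n" using V by (auto simp: mat_diag_def)
    have "(A k * V) $$ (i, j) = (A k *\<^sub>v col V j) $ i" using A[OF k] V ij by simp
    also have "\<dots> = V $$ (i, j) * c k j" using c[OF k ij(2)] V ij by simp
    also have "\<dots> = (V * mat_diag n (c k)) $$ (i, j)"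
      using ij V
      by (subst diagonal_mat_commute_index(2)[OF _ V diagonal_mat_mat_diag])
        (auto simp: mat_diag_def)
    finally show "(A k * V) $$ (i, j) = (V * mat_diag n (c k)) $$ (i, j)" .
  qed (use A[OF k] V in \<open>auto simp: mat_diag_def\<close>)
  show ?thesis
    using that[OF V det, of "\<lambda>k. mat_diag n (c k)"] AV diagonal_mat_mat_diag
    by (auto simp: mat_diag_def)
qed

section \<open>The completed slices commute\<close>

lemma hcat_carrier [simp]:
  "A \<in> carrier_mat n a \<Longrightarrow> B \<in> carrier_mat n b \<Longrightarrow> hcat A B \<in> carrier_mat n (a + b)"
  by (auto simp: hcat_def)

lemma hcat_index:
  assumes "A \<in> carrier_mat n a" "B \<in> carrier_mat n b" "i < n" "j < a + b"
  shows "hcat A B $$ (i, j) = (if j < a then A $$ (i, j) else B $$ (i, j - a))"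
  using assms by (auto simp: hcat_def)

lemma mult_hcat:
  assumes X: "X \<in> carrier_mat m n" and A: "A \<in> carrier_mat n a" and B: "B \<in> carrier_mat n b"
  shows "X * hcat A B = hcat (X * A) (X * B)"
proof (rule eq_matI)
  have H: "hcat (X * A) (X * B) \<in> carrier_mat m (a + b)" using assms by simp
  show "dim_row (X * hcat A B) = dim_row (hcat (X * A) (X * B))"
    "dim_col (X * hcat A B) = dim_col (hcat (X * A) (X * B))"
    using carrier_matD[OF H] carrier_matD[OF hcat_carrier[OF A B]] X by simp_all
  fix i j assume "i < dim_row (hcat (X * A) (X * B))" "j < dim_col (hcat (X * A) (X * B))"
  then have ij: "i < m" "j < a + b" using H by auto
  have "(X * hcat A B) $$ (i, j) = (\<Sum>l\<in>{0..<n}. X $$ (i, l) * hcat A B $$ (l, j))"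
    using ij X hcat_carrier[OF A B] by (auto simp: scalar_prod_def)
  also have "\<dots> = (\<Sum>l\<in>{0..<n}. X $$ (i, l) * (if j < a then A $$ (l, j) else B $$ (l, j - a)))"
    using ij by (intro sum.cong) (auto simp: hcat_index[OF A B])
  also have "\<dots> = hcat (X * A) (X * B) $$ (i, j)"
    using ij X A B by (subst hcat_index[of _ m a _ b]) (auto simp: scalar_prod_def)
  finally show "(X * hcat A B) $$ (i, j) = hcat (X * A) (X * B) $$ (i, j)" .
qed

text \<open>The splitting behind the affine structure of the linear system: the correction to a
  particular solution appears next to a zero block, as in \<open>homogeneous_system\<close>.\<close>

lemma hcat_add:
  assumes "A \<in> carrier_mat n a" "B \<in> carrier_mat n b" "C \<in> carrier_mat n b"
  shows "hcat A (B + C) = hcat A B + hcat (0\<^sub>m n a) C"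
  using assms by (intro eq_matI) (auto simp: hcat_def)

section \<open>Recovering matrices from stacked vectors\<close>

lemma vec_of_mat_eq_0D:
  assumes "A \<in> carrier_mat nr nc" and 0: "vec_of_mat A = 0\<^sub>v (dim_vec (vec_of_mat A))"
  shows "A = 0\<^sub>m nr nc"
proof (rule eq_matI)
  fix i j assume "i < dim_row (0\<^sub>m nr nc :: complex mat)" "j < dim_col (0\<^sub>m nr nc :: complex mat)"
  then have ij: "i < nr" "j < nc" by auto
  have "i + nr * j < nr * Suc j" using ij by simp
  also have "\<dots> \<le> nr * nc" using ij by (intro mult_le_mono2) simp
  finally have l: "i + nr * j < dim_vec (vec_of_mat A)" using assms by (simp add: vec_of_mat_def)
  have "A $$ (i, j) = vec_of_mat A $ (i + nr * j)"
    using l ij assms(1) by (auto simp: vec_of_mat_def)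
  also have "\<dots> = 0" by (subst 0) (simp add: l)
  finally show "A $$ (i, j) = 0\<^sub>m nr nc $$ (i, j)" using ij by simp
qed (use assms in auto)

text \<open>The zero vector takes its length from the vector it is compared with, so the total
  length of a residual never has to be computed.\<close>

lemma concat_vecs_eq_0:
  assumes "concat_vecs vs = 0\<^sub>v (dim_vec (concat_vecs vs))" "v \<in> set vs"
  shows "v = 0\<^sub>v (dim_vec v)"
proof (rule eq_vecI)
  fix i assume i: "i < dim_vec (0\<^sub>v (dim_vec v))"
  have "v $ i \<in> set (list_of_vec v)" using i by (auto simp: set_list_of_vec vec_set_def)
  then have "v $ i \<in> set (list_of_vec (concat_vecs vs))"
    using assms(2) by (auto simp: concat_vecs_def list_vec)
  also have "\<dots> \<subseteq> {0}"
    by (subst assms(1)) (auto simp: set_list_of_vec vec_set_def)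
  finally show "v $ i = 0\<^sub>v (dim_vec v) $ i" using i by simp
qed simp

lemma nth_concat_map_equal_length:
  assumes "\<And>x. x \<in> set xs \<Longrightarrow> length (f x) = L" "i < length xs" "l < L"
  shows "concat (map f xs) ! (i * L + l) = f (xs ! i) ! l"
  using assms
proof (induction xs arbitrary: i)
  case (Cons x xs)
  then show ?case by (cases i) (auto simp: nth_append)
qed simp

text \<open>The unknowns are numbered from 1, hence the offset \<open>k - 1\<close> of block
  \<open>k\<close>.\<close>

lemma stacked_index:
  assumes P: "\<And>k. k \<in> {1..<n3} \<Longrightarrow> P k \<in> carrier_mat nr nc" and k: "k \<in> {1..<n3}" and l: "l < nr * nc"
  shows "stacked n3 P $ ((k - 1) * (nr * nc) + l) = vec_of_mat (P k) $ l"
proof -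
  have "concat (map (\<lambda>k. list_of_vec (vec_of_mat (P k))) [1..<n3]) ! ((k - 1) * (nr * nc) + l)
    = list_of_vec (vec_of_mat (P ([1..<n3] ! (k - 1)))) ! l"
    using k l P by (intro nth_concat_map_equal_length) (auto simp: vec_of_mat_def)
  then show ?thesis using k by (simp add: stacked_def concat_vecs_def comp_def list_of_vec_index[symmetric] list_vec)
qed

text \<open>Undoes the vectorization: once \<open>N *\<^sub>v x\<close> is known to be a stacked
  family \<open>P'\<close>, its \<open>k\<close>-th row block is the column stacking of
  \<open>P' k\<close>, so the parametrized solution is a sum of matrices.\<close>

lemma param_sol_eq_add:
  assumes N: "N \<in> carrier_mat ((n3 - 1) * (r * (r - n2))) d" and x: "x \<in> carrier_vec d"
    and Nx: "N *\<^sub>v x = stacked n3 P'"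
    and P': "\<And>k. k \<in> {1..<n3} \<Longrightarrow> P' k \<in> carrier_mat r (r - n2)"
    and k: "k \<in> {1..<n3}" and P0: "P0 k \<in> carrier_mat r (r - n2)"
  shows "param_sol r n2 P0 N x k = P0 k + P' k"
proof (rule eq_matI)
  note P'k = P'[OF k]
  let ?L = "r * (r - n2)"
  fix i j assume "i < dim_row (P0 k + P' k)" "j < dim_col (P0 k + P' k)"
  then have ij: "i < r" "j < r - n2" using P'k by auto
  let ?l = "i + j * r"
  have "?l < r * Suc j" using ij by (simp add: mult.commute)
  also have "\<dots> \<le> ?L" using ij by (intro mult_le_mono2) simp
  finally have l: "?l < ?L" .
  \<comment> \<open>The row block of \<open>N\<close> for index \<open>k\<close> has height
    \<open>?L\<close>; truncated subtraction requires \<open>k\<close> to be positive here.\<close>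
  have kL: "k * ?L - (k - 1) * ?L = ?L" using k by (simp flip: diff_mult_distrib)
  have "(k - 1) * ?L + ?l < (k - 1) * ?L + ?L" using l by simp
  also have "\<dots> = k * ?L" using k by (cases k) auto
  also have "\<dots> \<le> (n3 - 1) * ?L" using k by (intro mult_le_mono1) auto
  finally have kl: "(k - 1) * ?L + ?l < (n3 - 1) * ?L" .
  have "(row_range N ((k - 1) * ?L) (k * ?L) *\<^sub>v x) $ ?l = (N *\<^sub>v x) $ ((k - 1) * ?L + ?l)"
    using l kl kL N x by (simp add: row_range_def scalar_prod_def)
  also have "\<dots> = vec_of_mat (P' k) $ ?l"
    unfolding Nx by (rule stacked_index[OF P' k l])
  finally have *: "(row_range N ((k - 1) * ?L) (k * ?L) *\<^sub>v x) $ ?l = vec_of_mat (P' k) $ ?l" .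
  have "param_sol r n2 P0 N x k $$ (i, j)
      = vec_of_mat (P0 k) $ ?l + (row_range N ((k - 1) * ?L) (k * ?L) *\<^sub>v x) $ ?l"
    using ij l kL by (simp add: param_sol_def mat_of_vec_def row_range_def del: index_mult_mat_vec)
  also have "\<dots> = (P0 k + P' k) $$ (i, j)"
    unfolding * using ij l P0 P'k by (simp add: vec_of_mat_def)
  finally show "param_sol r n2 P0 N x k $$ (i, j) = (P0 k + P' k) $$ (i, j)" .
qed (use P'[OF k] in \<open>auto simp: param_sol_def mat_of_vec_def\<close>)

lemma minus_mat_eq_0_iff:
  fixes A B :: "'a :: ab_group_add mat"
  assumes "A \<in> carrier_mat nr nc" "B \<in> carrier_mat nr nc"
  shows "A - B = 0\<^sub>m nr nc \<longleftrightarrow> A = B"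
  using assms by (auto simp: mat_eq_iff)

lemma param_sol_carrier [simp]: "param_sol r n2 P0 N x k \<in> carrier_mat r (r - n2)"
  by (simp add: param_sol_def mat_of_vec_def)

section \<open>The equations satisfied by the completed slices\<close>

text \<open>The vector \<open>N *\<^sub>v x\<close> lies in the column space of \<open>N\<close>,
  which is the solution space of the homogeneous system. So \<open>param_sol\<close> is a particular
  solution plus a homogeneous one, and their equations add up.\<close>

lemma param_sol_linear_equation:
  assumes T: "\<And>k. T k \<in> carrier_mat r n2" and n2: "n2 \<le> r"
    and P0: "second_stage_system r n2 n3 T ss lam P0"
    and N: "nullspace_basis r n2 n3 T ss d N" and x: "x \<in> carrier_vec d"
    and ij: "1 \<le> i" "i < j" "j < n3"
  shows "hcat (T i) (param_sol r n2 P0 N x i) * T j = hcat (T j) (param_sol r n2 P0 N x j) * T i"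
proof -
  let ?L = "(n3 - 1) * (r * (r - n2))"
  interpret vec_space "TYPE(complex)" ?L .
  have Nc: "N \<in> carrier_mat ?L d" using N by (simp add: nullspace_basis_def)
  have "N *\<^sub>v x \<in> col_space N" using col_space_eq[OF Nc] Nc x by auto
  also have "col_space N = {stacked n3 P | P. homogeneous_system r n2 n3 T ss P}"
    using N unfolding col_space_def nullspace_basis_def is_basis_of_def by blast
  finally obtain P' where Nx: "N *\<^sub>v x = stacked n3 P'" and P': "homogeneous_system r n2 n3 T ss P'"
    by auto
  have P'c: "P' k \<in> carrier_mat r (r - n2)" and P0c: "P0 k \<in> carrier_mat r (r - n2)"
    if "k \<in> {1..<n3}" for k
    using P' P0 that by (auto simp: homogeneous_system_def second_stage_system_def)
  have M: "hcat (T k) (param_sol r n2 P0 N x k) * T l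
      = hcat (T k) (P0 k) * T l + hcat (0\<^sub>m r n2) (P' k) * T l" if k: "k \<in> {1..<n3}" for k l
  proof -
    have "hcat A Q \<in> carrier_mat r r" if "A \<in> carrier_mat r n2" "Q \<in> carrier_mat r (r - n2)" for A Q
      using hcat_carrier[OF that] n2 by simp
    moreover have "param_sol r n2 P0 N x k = P0 k + P' k"
      using param_sol_eq_add[of N n3 r n2 d x P' k P0] Nc x Nx P'c P0c k by blast
    ultimately show ?thesis
      using P'c[OF k] P0c[OF k] T
      by (simp add: hcat_add[of _ r n2 _ "r - n2"] add_mult_distrib_mat[of _ r r _ "T l" n2])
  qed
  have c: "hcat A Q * T k \<in> carrier_mat r n2"
    if "A \<in> carrier_mat r n2" "Q \<in> carrier_mat r (r - n2)" for A Q k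
    using hcat_carrier[OF that] T n2 by (intro mult_carrier_mat[of _ r r]) auto
  have i: "i \<in> {1..<n3}" and j: "j \<in> {1..<n3}" using ij by auto
  have "hcat (T i) (P0 i) * T j - hcat (T j) (P0 j) * T i = 0\<^sub>m r n2"
    using P0 ij by (auto simp: second_stage_system_def)
  then have 1: "hcat (T i) (P0 i) * T j = hcat (T j) (P0 j) * T i"
    using c[OF T P0c[OF i]] c[OF T P0c[OF j]] by (subst (asm) minus_mat_eq_0_iff)
  have "hcat (0\<^sub>m r n2) (P' i) * T j - hcat (0\<^sub>m r n2) (P' j) * T i = 0\<^sub>m r n2"
    using P' ij by (auto simp: homogeneous_system_def)
  then have 2: "hcat (0\<^sub>m r n2) (P' i) * T j = hcat (0\<^sub>m r n2) (P' j) * T i"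
    using c[OF _ P'c[OF i]] c[OF _ P'c[OF j]] by (subst (asm) minus_mat_eq_0_iff) auto
  show ?thesis by (simp add: M[OF i] M[OF j] 1 2)
qed

text \<open>The difference of the two sides is, in vectorized form, one of the blocks concatenated
  in the residual, and all of these vanish.\<close>

lemma param_sol_quadratic_equation:
  assumes T: "\<And>k. T k \<in> carrier_mat r n2" and n2: "n2 \<le> r"
    and res: "residual r n2 n3 T P0 N x = 0\<^sub>v (dim_vec (residual r n2 n3 T P0 N x))"
    and ij: "1 \<le> i" "i < j" "j < n3"
  defines "P \<equiv> param_sol r n2 P0 N x"
  shows "hcat (T i) (P i) * P j = hcat (T j) (P j) * P i"
proof -
  have c: "hcat (T k) (P k) * P l \<in> carrier_mat r (r - n2)" for k l
    using hcat_carrier[OF T, of "P k" "r - n2" k] n2 by (auto simp: P_def intro!: mult_carrier_mat)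
  let ?B = "hcat (T i) (P i) * P j - hcat (T j) (P j) * P i"
  have "vec_of_mat ?B = 0\<^sub>v (dim_vec (vec_of_mat ?B))"
    using ij by (intro concat_vecs_eq_0[OF res[unfolded residual_def Let_def, folded P_def]]) force
  then have "?B = 0\<^sub>m r (r - n2)"
    using c by (intro vec_of_mat_eq_0D) (auto intro: minus_carrier_mat)
  then show ?thesis using c by (subst (asm) minus_mat_eq_0_iff)
qed

text \<open>The product \<open>M i * M j\<close> consists of \<open>M i * T j\<close> and
  \<open>M i * param_sol r n2 P0 N x j\<close> side by side. Exchanging \<open>i\<close> and
  \<open>j\<close> leaves the first block unchanged by the linear system and the second by the
  vanishing residual.\<close>

lemma completed_slices_commute:
  assumes T: "\<And>k. T k \<in> carrier_mat r n2" and n2: "n2 \<le> r"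
    and P0: "second_stage_system r n2 n3 T ss lam P0"
    and N: "nullspace_basis r n2 n3 T ss d N" and x: "x \<in> carrier_vec d"
    and res: "residual r n2 n3 T P0 N x = 0\<^sub>v (dim_vec (residual r n2 n3 T P0 N x))"
    and "i \<in> {1..<n3}" "j \<in> {1..<n3}"
  defines "M \<equiv> \<lambda>k. hcat (T k) (param_sol r n2 P0 N x k)"
  shows "M i * M j = M j * M i"
proof -
  have Mc: "M k \<in> carrier_mat r r" for k
    using hcat_carrier[OF T, of "param_sol r n2 P0 N x k" "r - n2" k] n2 by (simp add: M_def)
  have *: "M i * M j = M j * M i" if ij: "1 \<le> i" "i < j" "j < n3" for i j
  proof -
    have "M i * M j = hcat (M i * T j) (M i * param_sol r n2 P0 N x j)"
      using mult_hcat[OF Mc T param_sol_carrier] by (simp add: M_def)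
    also have "\<dots> = hcat (M j * T i) (M j * param_sol r n2 P0 N x i)"
      using param_sol_linear_equation[OF T n2 P0 N x ij]
        param_sol_quadratic_equation[OF T n2 res ij] by (simp add: M_def)
    also have "\<dots> = M j * M i"
      using mult_hcat[OF Mc T param_sol_carrier] by (simp add: M_def)
    finally show ?thesis .
  qed
  \<comment> \<open>The systems list each pair only once, with the smaller index first; the
    remaining cases follow by symmetry.\<close>
  consider "i < j" | "i = j" | "j < i" by linarith
  then show ?thesis
    by cases (use *[of i j] *[of j i] assms(7,8) in auto)
qed

section \<open>The decomposition\<close>

lemma cp_tensor_index:
  assumes "U \<in> carrier_mat n1 r" "V \<in> carrier_mat n2 r" "W \<in> carrier_mat n3 r"
  shows "cp_tensor U V W i j k = (if i < n1 \<and> j < n2 \<and> k < n3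
    then \<Sum>s<r. U $$ (i, s) * V $$ (j, s) * W $$ (k, s) else 0)"
  using assms by (auto simp: cp_tensor_def outer_def intro!: sum.cong)

text \<open>The index of the second argument varies slowest, so row \<open>l\<close> belongs to the
  index pair \<open>(l mod n2, l div n2)\<close>, the same order as in
  \<open>flatten1\<close>.\<close>

lemma khatri_rao_index:
  assumes "V \<in> carrier_mat n2 r" "W \<in> carrier_mat n3 r" "l < n2 * n3" "s < r"
  shows "khatri_rao V W $$ (l, s) = W $$ (l div n2, s) * V $$ (l mod n2, s)"
proof -
  have "l div n2 < n3" using assms by (simp add: less_mult_imp_div_less mult.commute)
  moreover have "l mod n2 < n2" using assms by (cases n2) auto
  ultimately show ?thesis
    using assms by (simp add: khatri_rao_def mat_of_cols_index kron_vec_def mult.commute)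
qed

lemma khatri_rao_carrier [simp]:
  "V \<in> carrier_mat n2 r \<Longrightarrow> W \<in> carrier_mat n3 r \<Longrightarrow> khatri_rao V W \<in> carrier_mat (n2 * n3) r"
  by (auto simp: khatri_rao_def mult.commute)

text \<open>Both sides of the matrix equation list the entries of a tensor in the same order. The
  hypothesis on \<open>F\<close> settles the indices outside the format, which a flattening does not
  see and where \<open>cp_tensor\<close> vanishes.\<close>

lemma khatri_rao_mult_eq_flatten1_iff:
  assumes U: "U \<in> carrier_mat n1 r" and V: "V \<in> carrier_mat n2 r" and W: "W \<in> carrier_mat n3 r"
    and F: "\<And>i j k. \<not> (i < n1 \<and> j < n2 \<and> k < n3) \<Longrightarrow> F i j k = 0"
  shows "khatri_rao V W * U\<^sup>T = (flatten1 n1 n2 n3 F)\<^sup>T \<longleftrightarrow> F = cp_tensor U V W"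
proof -
  have L: "(khatri_rao V W * U\<^sup>T) $$ (l, i) = cp_tensor U V W i (l mod n2) (l div n2)"
    if "l < n2 * n3" "i < n1" for l i
  proof -
    have "l div n2 < n3" using that by (simp add: less_mult_imp_div_less mult.commute)
    moreover have "l mod n2 < n2" using that by (cases n2) auto
    moreover have "(khatri_rao V W * U\<^sup>T) $$ (l, i)
        = (\<Sum>s\<in>{0..<r}. khatri_rao V W $$ (l, s) * U $$ (i, s))"
      using that U khatri_rao_carrier[OF V W] by (simp add: scalar_prod_def)
    ultimately show ?thesis
      using that khatri_rao_index[OF V W that(1)]
      by (auto simp: cp_tensor_index[OF U V W] atLeast0LessThan mult_ac intro!: sum.cong)
  qed
  have R: "(flatten1 n1 n2 n3 F)\<^sup>T $$ (l, i) = F i (l mod n2) (l div n2)"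
    if "l < n2 * n3" "i < n1" for l i
    using that by (simp add: flatten1_def)
  show ?thesis
  proof
    assume eq: "khatri_rao V W * U\<^sup>T = (flatten1 n1 n2 n3 F)\<^sup>T"
    have "F i j k = cp_tensor U V W i j k" for i j k
    proof (cases "i < n1 \<and> j < n2 \<and> k < n3")
      case True
      \<comment> \<open>Row \<open>j + n2 * k\<close> of the flattened equation is the one that
        carries the entry \<open>(i, j, k)\<close>.\<close>
      have "j + n2 * k < n2 * Suc k" using True by simp
      also have "\<dots> \<le> n2 * n3" using True by (intro mult_le_mono2) simp
      finally have l: "j + n2 * k < n2 * n3" .
      show ?thesis using R[OF l, of i] L[OF l, of i] eq True by simp
    qed (auto simp: F cp_tensor_index[OF U V W])
    then show "F = cp_tensor U V W" by blast
  next
    assume "F = cp_tensor U V W"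
    then show "khatri_rao V W * U\<^sup>T = (flatten1 n1 n2 n3 F)\<^sup>T"
      using L R U khatri_rao_carrier[OF V W]
      by (intro eq_matI) (simp_all add: flatten1_def del: index_mult_mat(1))
  qed
qed

section \<open>Consistent least squares systems\<close>

lemma norm2_eq_0_iff: "norm2 v = 0 \<longleftrightarrow> v = 0\<^sub>v (dim_vec v)"
  by (auto simp: norm2_def L2_set_eq_0_iff vec_eq_iff)

text \<open>An exact solution \<open>Y\<close> brings the minimum down to 0, and a residual of norm
  0 means exactness.\<close>

lemma least_squares_solution_consistent:
  assumes A: "A \<in> carrier_mat m n" and B: "B \<in> carrier_mat m p"
    and Y: "Y \<in> carrier_mat n p" "A * Y = B"
  shows "least_squares_solution A B X \<longleftrightarrow> X \<in> carrier_mat n p \<and> A * X = B"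
proof -
  have 0: "norm2 (vec_of_mat (0\<^sub>m m p)) = 0"
    unfolding norm2_eq_0_iff
  proof (rule eq_vecI)
    fix l assume "l < dim_vec (0\<^sub>v (dim_vec (vec_of_mat (0\<^sub>m m p))))"
    then have l: "l < m * p" by (simp add: vec_of_mat_def)
    then have "l div m < p" "l mod m < m"
      by (simp add: less_mult_imp_div_less mult.commute) (use l in \<open>cases m; simp\<close>)
    then show "vec_of_mat (0\<^sub>m m p) $ l = 0\<^sub>v (dim_vec (vec_of_mat (0\<^sub>m m p))) $ l"
      using l by (simp add: vec_of_mat_def)
  qed simp
  have eq0: "A * X - B = 0\<^sub>m m p \<longleftrightarrow> A * X = B" if "X \<in> carrier_mat n p" for X
    using A B that by (intro minus_mat_eq_0_iff) auto
  have nn: "norm2 v \<ge> 0" for v by (simp add: norm2_def L2_set_nonneg)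
  have ls_iff: "least_squares_solution A B X \<longleftrightarrow> X \<in> carrier_mat n p \<and>
      (\<forall>Z \<in> carrier_mat n p. norm2 (vec_of_mat (A * X - B)) \<le> norm2 (vec_of_mat (A * Z - B)))"
    unfolding least_squares_solution_def carrier_matD[OF A] carrier_matD[OF B] ..
  show ?thesis
  proof
    assume ls: "least_squares_solution A B X"
    then have X: "X \<in> carrier_mat n p" unfolding ls_iff by blast
    have "norm2 (vec_of_mat (A * X - B)) \<le> norm2 (vec_of_mat (A * Y - B))"
      using ls Y(1) unfolding ls_iff by blast
    also have "A * Y - B = 0\<^sub>m m p" using eq0[OF Y(1)] Y(2) by simp
    finally have "norm2 (vec_of_mat (A * X - B)) = 0" using 0 nn[of "vec_of_mat (A * X - B)"] by linarith
    then have "A * X - B = 0\<^sub>m m p"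
      using A B X by (intro vec_of_mat_eq_0D) (auto simp: norm2_eq_0_iff intro: minus_carrier_mat)
    then show "X \<in> carrier_mat n p \<and> A * X = B" using eq0[OF X] X by simp
  next
    assume X: "X \<in> carrier_mat n p \<and> A * X = B"
    then have "norm2 (vec_of_mat (A * X - B)) = 0" using eq0[of X] 0 by simp
    then show "least_squares_solution A B X" unfolding ls_iff using X nn by simp
  qed
qed

lemma U2_carrier [simp]: "S \<in> carrier_mat r r \<Longrightarrow> U2 n2 S \<in> carrier_mat n2 r"
  by (simp add: U2_def col_range_def)

lemma U3_carrier [simp]: "U3 n3 r D \<in> carrier_mat n3 r"
  by (simp add: U3_def)

text \<open>One exact decomposition with the given second and third factors makes the least squares
  system consistent, so that every minimizer yields an exact decomposition too.\<close>

lemma U1_candidate_iff: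
  assumes S: "S \<in> carrier_mat r r"
    and F: "\<And>i j k. \<not> (i < n1 \<and> j < n2 \<and> k < n3) \<Longrightarrow> F i j k = 0"
    and U: "U \<in> carrier_mat n1 r" "F = cp_tensor U (U2 n2 S) (U3 n3 r D)"
  shows "U1_candidate n1 n2 n3 r F S D X \<longleftrightarrow>
    X \<in> carrier_mat n1 r \<and> F = cp_tensor X (U2 n2 S) (U3 n3 r D)"
proof -
  note c = U2_carrier[OF S] U3_carrier
  have K: "khatri_rao (U2 n2 S) (U3 n3 r D) * Z\<^sup>T = (flatten1 n1 n2 n3 F)\<^sup>T
    \<longleftrightarrow> F = cp_tensor Z (U2 n2 S) (U3 n3 r D)" if "Z \<in> carrier_mat n1 r" for Z
    using khatri_rao_mult_eq_flatten1_iff[OF that c] F by blast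
  have "khatri_rao (U2 n2 S) (U3 n3 r D) * U\<^sup>T = (flatten1 n1 n2 n3 F)\<^sup>T"
    using K[OF U(1)] U(2) by blast
  then have "least_squares_solution (khatri_rao (U2 n2 S) (U3 n3 r D)) ((flatten1 n1 n2 n3 F)\<^sup>T) (X\<^sup>T)
    \<longleftrightarrow> X\<^sup>T \<in> carrier_mat r n1 \<and> khatri_rao (U2 n2 S) (U3 n3 r D) * X\<^sup>T = (flatten1 n1 n2 n3 F)\<^sup>T"
    using U(1) by (intro least_squares_solution_consistent[OF khatri_rao_carrier[OF c], where Y = "U\<^sup>T"])
      (auto simp: flatten1_def)
  then show ?thesis using K[of X] unfolding U1_candidate_def by auto
qed

section \<open>From a common diagonalizer to a tensor decomposition\<close>

text \<open>Only the first \<open>n2\<close> columns of \<open>S * M = D * S\<close> are read off,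
  so the completing blocks \<open>Q k\<close> drop out. The first slice fits the same pattern with
  the identity in place of \<open>D k\<close>, which explains the row of ones in
  \<open>U3\<close>.\<close>

lemma reduced_slice_index:
  assumes red: "reduction r n2 F C P" and n2: "n2 \<le> r"
    and S: "S \<in> carrier_mat r r"
    and D: "\<And>k. k \<in> {1..<n3} \<Longrightarrow> D k \<in> carrier_mat r r \<and> diagonal_mat (D k)"
    and Q: "\<And>k. k \<in> {1..<n3} \<Longrightarrow> Q k \<in> carrier_mat r (r - n2)"
    and SM: "\<And>k. k \<in> {1..<n3} \<Longrightarrow>
      S * hcat (reduced_slice r n2 F P k) (Q k) = D k * S"
    and k: "k < n3" and s: "s < r" and j: "j < n2"
  shows "(S * reduced_slice r n2 F P k) $$ (s, j) = U2 n2 S $$ (j, s) * U3 n3 r D $$ (k, s)"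
proof -
  have C: "C \<in> carrier_mat r (r - n2)" and P: "P \<in> carrier_mat r r"
    and PG: "P * hcat (slice r n2 F 0) C = 1\<^sub>m r"
    using red by (auto simp: reduction_def inverts_mat_def)
  have T: "reduced_slice r n2 F P k \<in> carrier_mat r n2" for k
    using P by (auto simp: reduced_slice_def slice_def)
  have sl: "slice r n2 F 0 \<in> carrier_mat r n2" by (simp add: slice_def)
  have "(S * reduced_slice r n2 F P k) $$ (s, j) = (if k = 0 then 1 else D k $$ (s, s)) * S $$ (s, j)"
  proof (cases "k = 0")
    case True
    \<comment> \<open>\<open>P * C\<close> completes the first reduced slice to the identity matrix,
      since \<open>P\<close> inverts \<open>hcat (slice r n2 F 0) C\<close>.\<close>
    have "S * hcat (reduced_slice r n2 F P 0) (P * C) = S * 1\<^sub>m r"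
      using mult_hcat[OF P sl C] PG by (simp add: reduced_slice_def)
    also have "\<dots> = S" using S by simp
    finally have "hcat (S * reduced_slice r n2 F P 0) (S * (P * C)) $$ (s, j) = S $$ (s, j)"
      using mult_hcat[OF S T[of 0], of "P * C" "r - n2"] P C by simp
    then show ?thesis using True s j n2 S P C T[of 0]
      by (subst (asm) hcat_index[of _ r n2 _ "r - n2"]) auto
  next
    case False
    then have k1: "k \<in> {1..<n3}" using k by auto
    have "hcat (S * reduced_slice r n2 F P k) (S * Q k) $$ (s, j) = (D k * S) $$ (s, j)"
      using mult_hcat[OF S T Q[OF k1], of k] SM[OF k1] by simp
    also have "\<dots> = D k $$ (s, s) * S $$ (s, j)"
      using diagonal_mat_commute_index(1)[of "D k" r S s j] D[OF k1] S s j n2 by simp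
    finally show ?thesis using False s j n2 S Q[OF k1] T[of k]
      by (subst (asm) hcat_index[of _ r n2 _ "r - n2"]) auto
  qed
  then show ?thesis using S s j k n2 by (simp add: U2_def U3_def col_range_def)
qed

text \<open>The inverse \<open>G\<close> of \<open>P\<close> undoes the reduction: a slice is
  \<open>G * ?T = (G * S') * (S * ?T)\<close> with \<open>S' * S = 1\<^sub>m r\<close>, and
  \<open>S * ?T\<close> is known from \<open>reduced_slice_index\<close>. Thus
  \<open>R = G * S'\<close> serves as first factor for the first \<open>r\<close> horizontal
  slices.\<close>

lemma cp_decomposition_from_diagonalization:
  assumes W: "W1 \<in> carrier_mat n1 r" "W2 \<in> carrier_mat n2 r" "W3 \<in> carrier_mat n3 r"
    and F: "F = cp_tensor W1 W2 W3"
    and n: "n2 \<le> r" "r \<le> n1"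
    and Y: "Y \<in> carrier_mat r r" "Y * mat r r (\<lambda>(i, s). W1 $$ (i, s)) = 1\<^sub>m r"
    and red: "reduction r n2 F C P"
    and S: "S \<in> carrier_mat r r" "invertible_mat S"
    and D: "\<And>k. k \<in> {1..<n3} \<Longrightarrow> D k \<in> carrier_mat r r \<and> diagonal_mat (D k)"
    and Q: "\<And>k. k \<in> {1..<n3} \<Longrightarrow> Q k \<in> carrier_mat r (r - n2)"
    and SM: "\<And>k. k \<in> {1..<n3} \<Longrightarrow> S * hcat (reduced_slice r n2 F P k) (Q k) = D k * S"
  shows "\<exists>U \<in> carrier_mat n1 r. F = cp_tensor U (U2 n2 S) (U3 n3 r D)"
proof -
  define G where "G = hcat (slice r n2 F 0) C"
  have P: "P \<in> carrier_mat r r" and GP: "G * P = 1\<^sub>m r" and C: "C \<in> carrier_mat r (r - n2)"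
    using red n by (auto simp: reduction_def inverts_mat_def G_def hcat_def slice_def)
  have G: "G \<in> carrier_mat r r"
    using hcat_carrier[OF _ C, of "slice r n2 F 0" n2] n by (simp add: G_def slice_def)
  obtain S' where S'S: "S' * S = 1\<^sub>m r" and S': "S' \<in> carrier_mat r r"
    using S unfolding invertible_mat_def inverts_mat_def
    by (metis carrier_matD carrier_matI index_mult_mat(2,3) index_one_mat(2,3))
  define R where "R = G * S'"
  \<comment> \<open>Row \<open>i\<close> of \<open>Z\<close> holds the coefficients expressing row
    \<open>i\<close> of \<open>W1\<close> through its first \<open>r\<close> rows; the horizontal
    slices of \<open>F\<close> obey the same relation.\<close>
  define Z where "Z = W1 * Y"
  have R: "R \<in> carrier_mat r r" and Z: "Z \<in> carrier_mat n1 r"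
    using G S' W Y by (auto simp: R_def Z_def)
  let ?X = "mat r r (\<lambda>(i, s). W1 $$ (i, s))"
  have X: "?X \<in> carrier_mat r r" by simp
  have ZX: "Z * ?X = W1"
    using assoc_mult_mat[OF W(1) Y(1) X] Y W by (simp add: Z_def)
  have rows: "F i j k = (\<Sum>l<r. Z $$ (i, l) * F l j k)" if "i < n1" "j < n2" "k < n3" for i j k
  proof -
    have "F i j k = (\<Sum>s<r. (Z * ?X) $$ (i, s) * W2 $$ (j, s) * W3 $$ (k, s))"
      unfolding ZX using that by (simp add: F cp_tensor_index[OF W])
    also have "\<dots> = (\<Sum>s<r. (\<Sum>l<r. Z $$ (i, l) * W1 $$ (l, s)) * W2 $$ (j, s) * W3 $$ (k, s))"
      using that Z by (intro sum.cong) (auto simp: scalar_prod_def atLeast0LessThan)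
    also have "\<dots> = (\<Sum>l<r. \<Sum>s<r. Z $$ (i, l) * (W1 $$ (l, s) * W2 $$ (j, s) * W3 $$ (k, s)))"
      by (subst sum.swap) (simp add: sum_distrib_left sum_distrib_right mult_ac)
    also have "\<dots> = (\<Sum>l<r. Z $$ (i, l) * F l j k)"
      using that n by (intro sum.cong) (auto simp: F cp_tensor_index[OF W] sum_distrib_left)
    finally show ?thesis .
  qed
  have top: "F i j k = (\<Sum>s<r. R $$ (i, s) * U2 n2 S $$ (j, s) * U3 n3 r D $$ (k, s))"
    if "i < r" "j < n2" "k < n3" for i j k
  proof -
    let ?T = "reduced_slice r n2 F P k"
    have sl: "slice r n2 F k \<in> carrier_mat r n2" by (simp add: slice_def)
    have T: "?T \<in> carrier_mat r n2" using P sl by (auto simp: reduced_slice_def)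
    have "R * (S * ?T) = G * (S' * (S * ?T))"
      using G S' S T by (simp add: R_def assoc_mult_mat[of _ r r _ r _ n2])
    also have "S' * (S * ?T) = ?T"
      using S' S T S'S by (simp flip: assoc_mult_mat[of _ r r _ r _ n2])
    also have "G * ?T = slice r n2 F k"
      using G P sl GP by (simp add: reduced_slice_def flip: assoc_mult_mat[of _ r r _ r _ n2])
    finally have "F i j k = (R * (S * ?T)) $$ (i, j)" using that by (simp add: slice_def)
    also have "\<dots> = (\<Sum>s<r. R $$ (i, s) * (S * ?T) $$ (s, j))"
      using that R S T by (simp add: scalar_prod_def atLeast0LessThan)
    also have "\<dots> = (\<Sum>s<r. R $$ (i, s) * U2 n2 S $$ (j, s) * U3 n3 r D $$ (k, s))"
      using that reduced_slice_index[where Q = Q and D = D, OF red n(1) S(1) D Q SM]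
      by (intro sum.cong) auto
    finally show ?thesis .
  qed
  \<comment> \<open>The witness \<open>Z * R\<close> extends the decomposition from the first
    \<open>r\<close> horizontal slices to all \<open>n1\<close> of them.\<close>
  have ZR: "Z * R \<in> carrier_mat n1 r" using Z R by simp
  have "F i j k = cp_tensor (Z * R) (U2 n2 S) (U3 n3 r D) i j k" for i j k
  proof (cases "i < n1 \<and> j < n2 \<and> k < n3")
    case True
    then have "F i j k = (\<Sum>l<r. \<Sum>s<r. Z $$ (i, l) * (R $$ (l, s) * U2 n2 S $$ (j, s) * U3 n3 r D $$ (k, s)))"
      by (subst rows) (auto simp: top sum_distrib_left intro!: sum.cong)
    also have "\<dots> = (\<Sum>s<r. (\<Sum>l<r. Z $$ (i, l) * R $$ (l, s)) * U2 n2 S $$ (j, s) * U3 n3 r D $$ (k, s))"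
      by (subst sum.swap) (simp add: sum_distrib_left sum_distrib_right mult_ac)
    also have "\<dots> = (\<Sum>s<r. (Z * R) $$ (i, s) * U2 n2 S $$ (j, s) * U3 n3 r D $$ (k, s))"
      using True Z R by (intro sum.cong) (auto simp: scalar_prod_def atLeast0LessThan)
    also have "\<dots> = cp_tensor (Z * R) (U2 n2 S) (U3 n3 r D) i j k"
      using True by (simp add: cp_tensor_index[OF ZR U2_carrier[OF S(1)] U3_carrier])
    finally show ?thesis .
  next
    case False
    then show ?thesis
      by (auto simp: F cp_tensor_index[OF W] cp_tensor_index[OF ZR U2_carrier[OF S(1)] U3_carrier])
  qed
  then show ?thesis using ZR by blast
qed

section \<open>Genericity and the theorem\<close>

lemma polynomial_fun_sum:
  "(\<And>i. i \<in> I \<Longrightarrow> polynomial_fun X (f i)) \<Longrightarrow> polynomial_fun X (\<lambda>a. \<Sum>i\<in>I. f i a)"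
  by (induction I rule: infinite_finite_induct)
    (auto intro: polynomial_fun.const polynomial_fun.add)

lemma polynomial_fun_prod:
  "(\<And>i. i \<in> I \<Longrightarrow> polynomial_fun X (f i)) \<Longrightarrow> polynomial_fun X (\<lambda>a. \<Prod>i\<in>I. f i a)"
  by (induction I rule: infinite_finite_induct)
    (auto intro: polynomial_fun.const polynomial_fun.mult)

text \<open>By the Leibniz expansion.\<close>

lemma polynomial_fun_det:
  assumes "\<And>i j. i < n \<Longrightarrow> j < n \<Longrightarrow> polynomial_fun X (\<lambda>a. f a i j)"
  shows "polynomial_fun X (\<lambda>a. det (mat n n (\<lambda>(i, j). f a i j)))"
proof -
  have "polynomial_fun X (\<lambda>a. \<Sum>p\<in>{p. p permutes {0..<n}}. signof p * (\<Prod>i\<in>{0..<n}. f a i (p i)))"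
    by (intro polynomial_fun_sum polynomial_fun_prod polynomial_fun.mult polynomial_fun.const assms)
      (auto dest: permutes_in_image)
  also have "(\<lambda>a. \<Sum>p\<in>{p. p permutes {0..<n}}. signof p * (\<Prod>i\<in>{0..<n}. f a i (p i)))
    = (\<lambda>a. det (mat n n (\<lambda>(i, j). f a i j)))"
    by (auto simp: fun_eq_iff det_def'[of _ n] permutes_in_image intro!: sum.cong prod.cong)
  finally show ?thesis .
qed

text \<open>The three genericity conditions are multiplied into a single polynomial, so that the
  exceptional set is one hypersurface. The factor from the first matrix serves both the linear
  relations between horizontal slices and the rank of the first slice; the other two serve the
  rank.\<close>

definition leading_minors_product :: "nat \<Rightarrow> nat \<Rightarrow> mat_triple \<Rightarrow> complex" where
  "leading_minors_product n2 r = (\<lambda>W.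
     det (mat r r (\<lambda>(i, j). fst W $$ (i, j))) * (\<Prod>s<r. snd (snd W) $$ (0, s)) *
     det (mat n2 n2 (\<lambda>(i, j). fst (snd W) $$ (i, j))))"

lemma polynomial_fun_leading_minors_product:
  assumes "r \<le> n1" "n2 \<le> r" "0 < n3"
  shows "polynomial_fun (entry_functions n1 n2 n3 r) (leading_minors_product n2 r)"
proof -
  have "(\<lambda>W. fst W $$ (i, s)) \<in> entry_functions n1 n2 n3 r" if "i < n1" "s < r" for i s
    using that by (auto simp: entry_functions_def fun_eq_iff)
  moreover have "(\<lambda>W. fst (snd W) $$ (i, s)) \<in> entry_functions n1 n2 n3 r" if "i < n2" "s < r" for i s
    using that by (auto simp: entry_functions_def fun_eq_iff)
  moreover have "(\<lambda>W. snd (snd W) $$ (i, s)) \<in> entry_functions n1 n2 n3 r" if "i < n3" "s < r" for i s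
    using that by (auto simp: entry_functions_def fun_eq_iff)
  ultimately show ?thesis
    unfolding leading_minors_product_def using assms
    by (intro polynomial_fun.mult polynomial_fun_prod polynomial_fun_det polynomial_fun.coord) auto
qed

lemma leading_minors_product_not_identically_0:
  assumes "0 < n3" "n2 \<le> r" "r \<le> n1"
  shows "\<exists>W \<in> mat_triples n1 n2 n3 r. leading_minors_product n2 r W \<noteq> 0"
proof -
  \<comment> \<open>Truncated identity matrices turn both minors into determinants of identity
    matrices; the third matrix of the witness has all entries 1.\<close>
  define \<delta> where "\<delta> n = mat n r (\<lambda>(i, j). if i = j then 1 else (0::complex))" for n
  have "mat r r (\<lambda>(i, j). \<delta> n1 $$ (i, j)) = 1\<^sub>m r" "mat n2 n2 (\<lambda>(i, j). \<delta> n2 $$ (i, j)) = 1\<^sub>m n2"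
    using assms by (auto simp: \<delta>_def intro!: eq_matI)
  then have "leading_minors_product n2 r (\<delta> n1, \<delta> n2, mat n3 r (\<lambda>_. 1)) \<noteq> 0"
    using assms by (simp add: leading_minors_product_def)
  moreover have "(\<delta> n1, \<delta> n2, mat n3 r (\<lambda>_. 1)) \<in> mat_triples n1 n2 n3 r"
    by (simp add: mat_triples_def \<delta>_def)
  ultimately show ?thesis by blast
qed

section \<open>Rank of the first slice\<close>

text \<open>A trivial kernel excludes linear dependence. Distinctness of the columns needs its own
  argument, because independence is stated for the set of columns, where repetitions
  disappear.\<close>

lemma (in vec_space) rank_eq_dim_colI:
  assumes A: "A \<in> carrier_mat n nc"
    and inj: "\<And>v. v \<in> carrier_vec nc \<Longrightarrow> A *\<^sub>v v = 0\<^sub>v n \<Longrightarrow> v = 0\<^sub>v nc"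
  shows "rank A = nc"
proof (rule lin_indpt_full_rank[OF A])
  show dist: "distinct (cols A)"
  proof (rule ccontr)
    assume "\<not> distinct (cols A)"
    then obtain i j where ij: "i < nc" "j < nc" "i \<noteq> j" "col A i = col A j"
      using A by (auto simp: distinct_conv_nth)
    \<comment> \<open>Two equal columns would put this nonzero vector into the kernel.\<close>
    let ?v = "unit_vec nc i - unit_vec nc j :: 'a vec"
    have "A *\<^sub>v ?v = A *\<^sub>v unit_vec nc i - A *\<^sub>v unit_vec nc j"
      using A by (intro mult_minus_distrib_mat_vec) auto
    also have "A *\<^sub>v unit_vec nc i = A *\<^sub>v unit_vec nc j"
    proof (rule eq_vecI)
      fix l assume "l < dim_vec (A *\<^sub>v unit_vec nc j)"
      then have l: "l < n" using A by simp
      have "A $$ (l, i) = A $$ (l, j)"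
        using A ij l by (metis carrier_matD index_col)
      then show "(A *\<^sub>v unit_vec nc i) $ l = (A *\<^sub>v unit_vec nc j) $ l"
        using A ij l by (simp add: scalar_prod_right_unit[where n = nc])
    qed simp
    also have "A *\<^sub>v unit_vec nc j - A *\<^sub>v unit_vec nc j = 0\<^sub>v n" using A by auto
    finally have "?v = 0\<^sub>v nc" using inj[of ?v] by simp
    then have "?v $ i = 0" using ij by simp
    then show False using ij by simp
  qed
  show "lin_indpt (set (cols A))"
    using lin_depE[OF A _ dist] inj by blast
qed

text \<open>The slice factors as the top of \<open>W1\<close>, times the diagonal matrix of the
  first row of \<open>W3\<close>, times the transpose of \<open>W2\<close>. Each factor is
  injective, the last one because its first \<open>n2\<close> rows form a nonsingular
  matrix.\<close>

lemma rank_slice_cp_tensor: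
  assumes W: "W1 \<in> carrier_mat n1 r" "W2 \<in> carrier_mat n2 r" "W3 \<in> carrier_mat n3 r"
    and n: "0 < n3" "n2 \<le> r" "r \<le> n1" and nz: "leading_minors_product n2 r (W1, W2, W3) \<noteq> 0"
  shows "vec_space.rank r (slice r n2 (cp_tensor W1 W2 W3) 0) = n2"
proof (rule vec_space.rank_eq_dim_colI)
  let ?A = "slice r n2 (cp_tensor W1 W2 W3) 0"
  let ?X1 = "mat r r (\<lambda>(i, j). W1 $$ (i, j))" and ?X2 = "mat n2 n2 (\<lambda>(i, j). W2 $$ (i, j))"
  have X: "?X1 \<in> carrier_mat r r" "?X2 \<in> carrier_mat n2 n2" by auto
  have X1: "det ?X1 \<noteq> 0" and X2: "det ?X2 \<noteq> 0" and w3: "\<And>s. s < r \<Longrightarrow> W3 $$ (0, s) \<noteq> 0"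
    using nz by (auto simp: leading_minors_product_def)
  show "?A \<in> carrier_mat r n2" by (simp add: slice_def)
  fix v :: "complex vec" assume v: "v \<in> carrier_vec n2" and 0: "?A *\<^sub>v v = 0\<^sub>v r"
  \<comment> \<open>\<open>z\<close> is the image of \<open>v\<close> under the last two factors;
    the top of \<open>W1\<close> maps it to 0.\<close>
  define z where "z = vec r (\<lambda>s. W3 $$ (0, s) * (\<Sum>j<n2. W2 $$ (j, s) * v $ j))"
  have "?X1 *\<^sub>v z = 0\<^sub>v r"
  proof (rule eq_vecI)
    fix i assume "i < dim_vec (0\<^sub>v r :: complex vec)"
    then have i: "i < r" by simp
    have "(?X1 *\<^sub>v z) $ i
      = (\<Sum>s<r. \<Sum>j<n2. W1 $$ (i, s) * W2 $$ (j, s) * W3 $$ (0, s) * v $ j)"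
      using i by (simp add: z_def scalar_prod_def atLeast0LessThan sum_distrib_left mult_ac)
    also have "\<dots> = (\<Sum>j<n2. (\<Sum>s<r. W1 $$ (i, s) * W2 $$ (j, s) * W3 $$ (0, s)) * v $ j)"
      by (subst sum.swap) (simp add: sum_distrib_right)
    also have "\<dots> = (?A *\<^sub>v v) $ i"
      using i v n by (simp add: scalar_prod_def slice_def atLeast0LessThan cp_tensor_index[OF W])
    also have "\<dots> = 0" using 0 i by simp
    finally show "(?X1 *\<^sub>v z) $ i = 0\<^sub>v r $ i" using i by simp
  qed simp
  moreover have "z \<in> carrier_vec r" by (simp add: z_def)
  ultimately have z: "z = 0\<^sub>v r" using X1 det_0_iff_vec_prod_zero_field[OF X(1)] by blast
  have "?X2\<^sup>T *\<^sub>v v = 0\<^sub>v n2"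
  proof (rule eq_vecI)
    fix s assume "s < dim_vec (0\<^sub>v n2 :: complex vec)"
    then have s: "s < n2" by simp
    have "z $ s = 0" using z s n by simp
    then have "(\<Sum>j<n2. W2 $$ (j, s) * v $ j) = 0" using w3[of s] s n by (simp add: z_def)
    then show "(?X2\<^sup>T *\<^sub>v v) $ s = 0\<^sub>v n2 $ s"
      using s v by (simp add: scalar_prod_def atLeast0LessThan)
  qed simp
  moreover have "det (?X2\<^sup>T) \<noteq> 0" using X2 det_transpose[OF X(2)] by simp
  ultimately show "v = 0\<^sub>v n2"
    using det_0_iff_vec_prod_zero_field[of "?X2\<^sup>T" n2] X(2) v by auto
qed

text \<open>Used for \<open>n3 = 0\<close>, where the format admits only the zero tensor.\<close>

lemma tensor_rank_0:
  "tensor_rank n1 n2 n3 (\<lambda>_ _ _. 0) = 0"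
  unfolding tensor_rank_def by (intro Least_eq_0) auto

section \<open>Diagonalization by left eigenvectors\<close>

lemma det_nonzero_imp_inverse:
  fixes A :: "'a :: field mat"
  assumes "A \<in> carrier_mat n n" "det A \<noteq> 0"
  obtains B where "B \<in> carrier_mat n n" "A * B = 1\<^sub>m n" "B * A = 1\<^sub>m n"
  using det_non_zero_imp_unit[OF assms, of "()"] by (auto simp: Units_def ring_mat_simps)

text \<open>Passes from left eigenvectors, the rows of \<open>S\<close>, to right eigenvectors, the
  columns of its inverse \<open>V\<close>.\<close>

lemma diagonalizes_imp_similar_mat_wit:
  assumes M: "M \<in> carrier_mat r r" and "diagonalizes r S D M"
  shows "\<exists>V. similar_mat_wit M D V S"
proof -
  have S: "S \<in> carrier_mat r r" and inv: "invertible_mat S" and D: "D \<in> carrier_mat r r"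
    and SM: "S * M = D * S"
    using assms(2) by (auto simp: diagonalizes_def)
  obtain V where VS: "V * S = 1\<^sub>m r" and V: "V \<in> carrier_mat r r"
    using S inv unfolding invertible_mat_def inverts_mat_def
    by (metis carrier_matD carrier_matI index_mult_mat(2,3) index_one_mat(2,3))
  have "M = (V * S) * M" using M VS by simp
  also have "\<dots> = V * D * S"
    using SM V S D M by (simp add: assoc_mult_mat[of _ r r _ r _ r])
  finally have "M = V * D * S" .
  then have "similar_mat_wit M D V S"
    using V S M D VS mat_mult_left_right_inverse[OF V S VS] by (intro similar_mat_witI[of _ _ r]) auto
  then show ?thesis by blast
qed

text \<open>The way back: the common \<open>S\<close> is the inverse of the matrix \<open>V\<close>
  of joint right eigenvectors.\<close>

lemma commuting_family_diagonalizes: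
  fixes M :: "'k \<Rightarrow> complex mat"
  assumes K: "finite K" and M: "\<And>k. k \<in> K \<Longrightarrow> M k \<in> carrier_mat r r"
    and diag: "\<And>k. k \<in> K \<Longrightarrow> \<exists>S D. diagonalizes r S D (M k)"
    and com: "\<And>i j. i \<in> K \<Longrightarrow> j \<in> K \<Longrightarrow> M i * M j = M j * M i"
  shows "\<exists>S D. \<forall>k\<in>K. diagonalizes r S (D k) (M k)"
proof -
  have sim: "\<And>k. k \<in> K \<Longrightarrow> \<exists>D V W. similar_mat_wit (M k) D V W \<and> diagonal_mat D"
    using diag diagonalizes_imp_similar_mat_wit[OF M] unfolding diagonalizes_def by blast
  obtain V D where V: "V \<in> carrier_mat r r" "det V \<noteq> 0"
    and D: "\<And>k. k \<in> K \<Longrightarrow> D k \<in> carrier_mat r r \<and> diagonal_mat (D k) \<and> M k * V = V * D k"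
    by (rule simultaneous_diagonalization[of K M r, OF K M sim com]) blast+
  obtain S where S: "S \<in> carrier_mat r r" and VS: "V * S = 1\<^sub>m r" and SV: "S * V = 1\<^sub>m r"
    using det_nonzero_imp_inverse[OF V] by metis
  have inv: "invertible_mat S"
    unfolding invertible_mat_def inverts_mat_def using S V VS SV by auto
  have "S * M k = D k * S" if k: "k \<in> K" for k
  proof -
    note as = assoc_mult_mat[of _ r r _ r _ r]
    have Dk: "D k \<in> carrier_mat r r" using D k by simp
    have "S * M k = S * (M k * (V * S))" using M[OF k] S VS by simp
    also have "\<dots> = S * ((M k * V) * S)" using M[OF k] S V(1) by (simp add: as)
    also have "M k * V = V * D k" using D k by simp
    also have "S * ((V * D k) * S) = (S * V) * (D k * S)" using S V(1) Dk by (simp add: as)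
    also have "\<dots> = D k * S" using SV S Dk by simp
    finally show ?thesis .
  qed
  then show ?thesis using S inv D unfolding diagonalizes_def by blast
qed

text \<open>The rank clause expresses that the reduction is possible generically. The decomposition
  is asserted for every common diagonalizer \<open>S\<close> with its own diagonal matrices, not
  just for one suitable choice.\<close>

theorem theorem3p6:
  fixes n1 n2 n3 r :: nat
  assumes "n1 \<ge> n2" and "n2 \<ge> n3" and "n2 < r" and "r \<le> n1"
  shows "generically n1 n2 n3 r (\<lambda>F.
    vec_space.rank r (slice r n2 F 0) = n2 \<and>
    (\<forall>C P T ss lam P0 d N x M.
       reduction r n2 F C P \<and>
       T = reduced_slice r n2 F P \<and>
       first_stage_vectors r n2 n3 T ss lam \<and>
       second_stage_system r n2 n3 T ss lam P0 \<and>
       nullspace_basis r n2 n3 T ss d N \<and>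
       global_minimizer d (residual r n2 n3 T P0 N) x \<and>
       residual r n2 n3 T P0 N x = 0\<^sub>v (dim_vec (residual r n2 n3 T P0 N x)) \<and>
       M = (\<lambda>k. hcat (T k) (param_sol r n2 P0 N x k)) \<and>
       (\<forall>k \<in> {1..<n3}. \<exists>Sk Dk. diagonalizes r Sk Dk (M k))
     \<longrightarrow>
       (\<exists>S D. \<forall>k \<in> {1..<n3}. diagonalizes r S (D k) (M k)) \<and>
       (\<forall>S D. S \<in> carrier_mat r r \<and> invertible_mat S \<and>
              (\<forall>k \<in> {1..<n3}. diagonalizes r S (D k) (M k)) \<longrightarrow>
          (\<exists>U1. U1_candidate n1 n2 n3 r F S D U1) \<and>
          (\<forall>U1. U1_candidate n1 n2 n3 r F S D U1 \<longrightarrow>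
             F = cp_tensor U1 (U2 n2 S) (U3 n3 r D)))))"
    (is "generically n1 n2 n3 r ?\<Phi>")
proof (cases "n3 = 0")
  case True
  \<comment> \<open>With no slices every tensor has rank 0, while \<open>n2 < r\<close> makes
    \<open>r\<close> positive; so no tensor of rank \<open>r\<close> exists and the empty
    exceptional set will do.\<close>
  have "cp_tensor W1 W2 W3 = (\<lambda>_ _ _. 0)" if "(W1, W2, W3) \<in> mat_triples n1 n2 n3 r" for W1 W2 W3
    using that True by (auto simp: mat_triples_def cp_tensor_index fun_eq_iff)
  then have "tensor_rank n1 n2 n3 (cp_tensor W1 W2 W3) \<noteq> r"
    if "(W1, W2, W3) \<in> mat_triples n1 n2 n3 r" for W1 W2 W3
    using that tensor_rank_0 assms by simp
  moreover have "zariski_closed n1 n2 n3 r {}"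
    unfolding zariski_closed_def
    by (intro exI[of _ "{\<lambda>_. 1}"]) (auto intro: polynomial_fun.const)
  moreover have "{} \<noteq> mat_triples n1 n2 n3 r"
    by (auto simp: mat_triples_def intro: zero_carrier_mat)
  ultimately show ?thesis unfolding generically_def by (intro exI[of _ "{}"]) blast
next
  case False
  then have n3: "0 < n3" by simp
  have n: "n2 \<le> r" "r \<le> n1" using assms by auto
  define Z where "Z = {W \<in> mat_triples n1 n2 n3 r. leading_minors_product n2 r W = 0}"
  have "zariski_closed n1 n2 n3 r Z"
    unfolding zariski_closed_def Z_def
    using polynomial_fun_leading_minors_product[OF n(2,1) n3]
    by (intro exI[of _ "{leading_minors_product n2 r}"]) auto
  moreover have "Z \<noteq> mat_triples n1 n2 n3 r"
    using leading_minors_product_not_identically_0[OF n3 n] by (auto simp: Z_def)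
  moreover have "?\<Phi> (cp_tensor W1 W2 W3)" if "(W1, W2, W3) \<in> mat_triples n1 n2 n3 r - Z" for W1 W2 W3
  proof -
    have W: "W1 \<in> carrier_mat n1 r" "W2 \<in> carrier_mat n2 r" "W3 \<in> carrier_mat n3 r"
      and nz: "leading_minors_product n2 r (W1, W2, W3) \<noteq> 0"
      using that by (auto simp: mat_triples_def Z_def)
    define F where "F = cp_tensor W1 W2 W3"
    have F0: "F i j k = 0" if "\<not> (i < n1 \<and> j < n2 \<and> k < n3)" for i j k
      using that by (auto simp: F_def cp_tensor_index[OF W])
    have "det (mat r r (\<lambda>(i, s). W1 $$ (i, s))) \<noteq> 0"
      using nz by (auto simp: leading_minors_product_def)
    then obtain Y where Y: "Y \<in> carrier_mat r r" "Y * mat r r (\<lambda>(i, s). W1 $$ (i, s)) = 1\<^sub>m r"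
      using det_nonzero_imp_inverse[of "mat r r (\<lambda>(i, s). W1 $$ (i, s))" r] by auto
    show ?thesis
      unfolding F_def[symmetric]
    proof (rule conjI[OF rank_slice_cp_tensor[OF W n3 n nz, folded F_def]], intro allI impI, elim conjE)
      fix C P T ss lam P0 d N x M
      assume red: "reduction r n2 F C P" and T_eq: "T = reduced_slice r n2 F P"
        and P0: "second_stage_system r n2 n3 T ss lam P0"
        and N: "nullspace_basis r n2 n3 T ss d N"
        and x: "global_minimizer d (residual r n2 n3 T P0 N) x"
        and res: "residual r n2 n3 T P0 N x = 0\<^sub>v (dim_vec (residual r n2 n3 T P0 N x))"
        and M_eq: "M = (\<lambda>k. hcat (T k) (param_sol r n2 P0 N x k))"
        and diag: "\<forall>k \<in> {1..<n3}. \<exists>Sk Dk. diagonalizes r Sk Dk (M k)"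
      have xc: "x \<in> carrier_vec d" using x by (simp add: global_minimizer_def)
      have T: "T k \<in> carrier_mat r n2" for k
        using red by (auto simp: T_eq reduced_slice_def slice_def reduction_def)
      have Q: "param_sol r n2 P0 N x k \<in> carrier_mat r (r - n2)" for k by simp
      have M: "M k \<in> carrier_mat r r" for k
        using hcat_carrier[OF T Q, of k k] n by (simp add: M_eq)
      have "\<exists>S D. \<forall>k \<in> {1..<n3}. diagonalizes r S (D k) (M k)"
        using diag M completed_slices_commute[OF T n(1) P0 N xc res]
        by (intro commuting_family_diagonalizes) (auto simp: M_eq)
      \<comment> \<open>Here \<open>S\<close> is an arbitrary common diagonalizer, not necessarily
        the one just constructed. One exact first factor \<open>U\<close> for it gives both the
        existence of a least squares solution and the exactness of all of them.\<close>
      moreover have "(\<exists>U1. U1_candidate n1 n2 n3 r F S D U1) \<and>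
          (\<forall>U1. U1_candidate n1 n2 n3 r F S D U1 \<longrightarrow> F = cp_tensor U1 (U2 n2 S) (U3 n3 r D))"
        if S: "S \<in> carrier_mat r r" "invertible_mat S"
          and SD: "\<forall>k \<in> {1..<n3}. diagonalizes r S (D k) (M k)" for S D
      proof -
        have D: "\<And>k. k \<in> {1..<n3} \<Longrightarrow> D k \<in> carrier_mat r r \<and> diagonal_mat (D k)"
          and SM: "\<And>k. k \<in> {1..<n3} \<Longrightarrow> S * hcat (T k) (param_sol r n2 P0 N x k) = D k * S"
          using SD by (auto simp: diagonalizes_def M_eq)
        obtain U where U: "U \<in> carrier_mat n1 r" "F = cp_tensor U (U2 n2 S) (U3 n3 r D)"
          using cp_decomposition_from_diagonalization[OF W F_def n Y red S D Q SM[unfolded T_eq]]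
          unfolding T_eq by blast
        have "U1_candidate n1 n2 n3 r F S D X \<longleftrightarrow>
            X \<in> carrier_mat n1 r \<and> F = cp_tensor X (U2 n2 S) (U3 n3 r D)" for X
          by (rule U1_candidate_iff[OF S(1) _ U]) (rule F0)
        then show ?thesis using U by blast
      qed
      ultimately show "(\<exists>S D. \<forall>k \<in> {1..<n3}. diagonalizes r S (D k) (M k)) \<and>
        (\<forall>S D. S \<in> carrier_mat r r \<and> invertible_mat S \<and>
              (\<forall>k \<in> {1..<n3}. diagonalizes r S (D k) (M k)) \<longrightarrow>
          (\<exists>U1. U1_candidate n1 n2 n3 r F S D U1) \<and>
          (\<forall>U1. U1_candidate n1 n2 n3 r F S D U1 \<longrightarrow>
             F = cp_tensor U1 (U2 n2 S) (U3 n3 r D)))"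
        by blast
    qed
  qed
  then have "\<forall>(W1, W2, W3) \<in> mat_triples n1 n2 n3 r - Z.
      tensor_rank n1 n2 n3 (cp_tensor W1 W2 W3) = r \<longrightarrow> ?\<Phi> (cp_tensor W1 W2 W3)"
    by blast
  ultimately show ?thesis unfolding generically_def by (intro exI[of _ Z] conjI)
qed

end
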